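(* Let $m\ge 0$. Every eigenfunction of $-\Delta_{m+1}$ is either (a) born on level $m+1$, with eigenvalue $1$ or $3$, where the eigenvalue $1$ has multiplicity $5^m$ and the eigenvalue $3$ has multiplicity $5^m+1$; or (b) an extension (from $K_m$ to $K_{m+1}$) of an eigenfunction of $-\Delta_m$ with some eigenvalue $\lambda$, and then its eigenvalue is $\lambda'=\varphi_1(\lambda)$, $\varphi_2(\lambda)$ or $\varphi_3(\lambda)$, except that if $\lambda=0$ only $\lambda'=\varphi_1(0)=0$ and $\lambda'=\varphi_3(0)=5$ are allowed. Moreover, for each eigenvalue $\lambda$ of $-\Delta_m$ and each allowed choice of $i\in\{1,2,3\}$, the number $\varphi_i(\lambda)$ is an eigenvalue of $-\Delta_{m+1}$ with the same multiplicity as $\lambda$ has as an eigenvalue of $-\Delta_m$.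
   Context: Identify the circle with $\mathbb{R}/\mathbb{Z}$ (so $0=1$). For $m\ge 0$ consider the $2\cdot 5^m$ points $\frac{n}{2\cdot 5^m}$, $1\le n\le 2\cdot 5^m$. Each such $n$ is uniquely $n=5^k(a+5j)$ with $k,j\ge 0$ integers and $a\in\{1,2,3,4\}$. Identify these points in pairs by $$\frac{5^k(1+5j)}{2\cdot 5^m}\sim\frac{5^k(2+5j)}{2\cdot 5^m},\qquad \frac{5^k(3+5j)}{2\cdot 5^m}\sim\frac{5^k(4+5j)}{2\cdot 5^m}$$ (for example $\frac12\sim 1$). These identifications are consistent for different $m$. The graph $K_m$ has as vertices the $5^m$ identified pairs, and as edges the arcs joining consecutive points $\frac{n}{2\cdot5^m}$, $\frac{n+1}{2\cdot5^m}$ of the circle (loops may occur). Functions on $K_m$ are real functions $u$ on these points with $u(x)=u(y)$ whenever $x\sim y$. For a vertex $x\sim y$ let $N_m(x)$ be the list (with multiplicity) of the four points $x\pm\frac{1}{2\cdot5^m}$, $y\pm\frac1{2\cdot5^m}$. The Laplacian on $K_m$ is $$-\Delta_m u(x)=\sum_{z\in N_m(x)}(u(x)-u(z)).$$ The vertices of $K_m$ are also vertices of $K_{m+1}$; they are called the old vertices of $K_{m+1}$. An eigenfunction of $-\Delta_{m+1}$ is born on level $m+1$ if it vanishes at all old vertices of $K_{m+1}$. A function $\tilde u$ on $K_{m+1}$ is an extension of a function $u$ on $K_m$ if $\tilde u=u$ at the old vertices. Multiplicity of an eigenvalue means the dimension of its eigenspace. Let $R(x)=x(3-x)(5-x)$.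 For $y\in[0,4+\sqrt2]$ the equation $R(x)=y$ has three distinct real solutions, denoted $\varphi_1(y)<\varphi_2(y)<\varphi_3(y)$. All eigenvalues of $-\Delta_m$ lie in $[0,4+\sqrt2]$. *)

theory Defs
  imports Complex_Main "HOL-Library.Function_Algebras"
begin

text \<open>
  The circle \<open>\<real>/\<int>\<close> is represented by the fundamental domain \<open>{0<..1}\<close>, so that the
  point \<open>0 = 1\<close> is the real number \<open>1\<close>, and \<open>wrap\<close> is the reduction modulo 1 to this domain.
\<close>

definition wrap :: "real \<Rightarrow> real" where
  "wrap t = t - of_int \<lceil>t\<rceil> + 1"

definition pt :: "nat \<Rightarrow> nat \<Rightarrow> real" where
  "pt m n = real n / (2 * 5 ^ m)"

definition points :: "nat \<Rightarrow> real set" where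
  "points m = pt m ` {1..2 * 5 ^ m}"

text \<open>
  \<open>ident m\<close> relates the two distinct points of an identified pair; it is symmetric, but not
  reflexive.
\<close>

definition ident :: "nat \<Rightarrow> real \<Rightarrow> real \<Rightarrow> bool" where
  "ident m x y \<longleftrightarrow> x \<in> points m \<and> y \<in> points m \<and>
     (\<exists>k j. {x, y} = {pt m (5 ^ k * (1 + 5 * j)), pt m (5 ^ k * (2 + 5 * j))} \<or>
            {x, y} = {pt m (5 ^ k * (3 + 5 * j)), pt m (5 ^ k * (4 + 5 * j))})"

definition mate :: "nat \<Rightarrow> real \<Rightarrow> real" where
  "mate m x = (THE y. ident m x y)"

text \<open>
  Functions on the graph are functions on the points that respect the identifications. They are
  extended by 0 outside the points, so that equality of functions is equality on the points.
\<close>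

definition graph_functions :: "nat \<Rightarrow> (real \<Rightarrow> real) set" where
  "graph_functions m =
     {u. (\<forall>x. x \<notin> points m \<longrightarrow> u x = 0) \<and> (\<forall>x y. ident m x y \<longrightarrow> u x = u y)}"

definition neighbours :: "nat \<Rightarrow> real \<Rightarrow> real list" where
  "neighbours m x =
     (let h = 1 / (2 * 5 ^ m); y = mate m x
      in [wrap (x + h), wrap (x - h), wrap (y + h), wrap (y - h)])"

definition neg_laplacian :: "nat \<Rightarrow> (real \<Rightarrow> real) \<Rightarrow> real \<Rightarrow> real" where
  "neg_laplacian m u x = (\<Sum>z\<leftarrow>neighbours m x. u x - u z)"

definition eigenspace :: "nat \<Rightarrow> real \<Rightarrow> (real \<Rightarrow> real) set" where
  "eigenspace m l =
     {u \<in> graph_functions m. \<forall>x\<in>points m. neg_laplacian m u x = l * u x}"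

definition eigenfunction :: "nat \<Rightarrow> real \<Rightarrow> (real \<Rightarrow> real) \<Rightarrow> bool" where
  "eigenfunction m l u \<longleftrightarrow> u \<in> eigenspace m l \<and> u \<noteq> 0"

definition eigenvalue :: "nat \<Rightarrow> real \<Rightarrow> bool" where
  "eigenvalue m l \<longleftrightarrow> (\<exists>u. eigenfunction m l u)"

definition scale_fun :: "real \<Rightarrow> (real \<Rightarrow> real) \<Rightarrow> real \<Rightarrow> real" where
  "scale_fun c u = (\<lambda>x. c * u x)"

interpretation real_functions: vector_space scale_fun
  by unfold_locales (auto simp: scale_fun_def fun_eq_iff algebra_simps)

definition eigen_multiplicity :: "nat \<Rightarrow> real \<Rightarrow> nat" where
  "eigen_multiplicity m l = real_functions.dim (eigenspace m l)"

text \<open>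
  The old vertices of the graph at level \<open>m + 1\<close> are the pairs consisting of points in
  \<open>points m\<close>. In \<open>extension_of m v u\<close>, the function \<open>v\<close> at level \<open>m + 1\<close> extends \<open>u\<close>.
\<close>

definition born_next :: "nat \<Rightarrow> (real \<Rightarrow> real) \<Rightarrow> bool" where
  "born_next m u \<longleftrightarrow> (\<forall>x\<in>points m. u x = 0)"

definition extension_of :: "nat \<Rightarrow> (real \<Rightarrow> real) \<Rightarrow> (real \<Rightarrow> real) \<Rightarrow> bool" where
  "extension_of m v u \<longleftrightarrow> v \<in> graph_functions (Suc m) \<and> u \<in> graph_functions m \<and>
     (\<forall>x\<in>points m. v x = u x)"

definition R :: "real \<Rightarrow> real" where
  "R x = x * (3 - x) * (5 - x)"

text \<open>
  \<open>\<phi> i y\<close> is the \<open>i\<close>-th smallest solution of \<open>R x = y\<close>, for \<open>i \<in> {1, 2, 3}\<close>. It is only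
  meaningful if there are three solutions; see \<open>R_three_solutions\<close> and \<open>\<phi>_solutions\<close> below.
\<close>

definition \<phi> :: "nat \<Rightarrow> real \<Rightarrow> real" where
  "\<phi> i y = sorted_list_of_set {x. R x = y} ! (i - 1)"

definition allowed :: "real \<Rightarrow> nat set" where
  "allowed l = (if l = 0 then {1, 3} else {1, 2, 3})"


subsection \<open>Well-definedness\<close>

lemma R_three_solutions:
  assumes "0 \<le> y" "y \<le> 4 + sqrt 2"
  obtains a b c where "a < b" "b < c" "{x. R x = y} = {a, b, c}"
proof -
  have s: "sqrt 2 < 3/2" by (rule real_less_lsqrt) (auto simp: power2_eq_square)
  have cont: "isCont R x" for x unfolding R_def by (intro continuous_intros)
  have "\<exists>a\<ge>0. a \<le> 1 \<and> R a = y"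
    using IVT[of R 0 y 1] cont assms s by (auto simp: R_def)
  then obtain a where a: "0 \<le> a" "a \<le> 1" "R a = y" by auto
  have a1: "a \<noteq> 1" using a assms s by (auto simp: R_def)
  have "\<exists>b\<ge>1. b \<le> 3 \<and> R b = y"
    using IVT2[of R 3 y 1] cont assms s by (auto simp: R_def)
  then obtain b where b: "1 \<le> b" "b \<le> 3" "R b = y" by auto
  have "\<exists>c\<ge>4. c \<le> 6 \<and> R c = y"
    using IVT[of R 4 y 6] cont assms s by (auto simp: R_def)
  then obtain c where c: "4 \<le> c" "c \<le> 6" "R c = y" by auto
  have ab: "a < b" and bc: "b < c" using a a1 b c by auto
  have "x \<in> {a, b, c}" if x: "R x = y" for x
  proof (rule ccontr)
    assume n: "x \<notin> {a, b, c}"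
    have q: "s\<^sup>2 + s * t + t\<^sup>2 - 8 * (s + t) + 15 = 0" if "R s = R t" "s \<noteq> t" for s t
    proof -
      have "(s - t) * (s\<^sup>2 + s * t + t\<^sup>2 - 8 * (s + t) + 15) = R s - R t"
        by (simp add: R_def power2_eq_square algebra_simps)
      then show ?thesis using that by simp
    qed
    have r: "s + t + w = 8" if "R s = R t" "R s = R w" "s \<noteq> t" "s \<noteq> w" "t \<noteq> w" for s t w
    proof -
      have "(t - w) * (s + t + w - 8) = 0"
        using q[of s t] q[of s w] that by (simp add: power2_eq_square algebra_simps)
      then show ?thesis using that by simp
    qed
    have "a + b + c = 8" "a + b + x = 8"
      using r[of a b c] r[of a b x] a b c ab bc n x by auto
    then show False using n by auto
  qed
  then have "{x. R x = y} = {a, b, c}" using a b c by auto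
  with ab bc show thesis by (rule that)
qed

lemma \<phi>_solutions:
  assumes "0 \<le> y" "y \<le> 4 + sqrt 2"
  shows "\<phi> 1 y < \<phi> 2 y" "\<phi> 2 y < \<phi> 3 y" "{x. R x = y} = {\<phi> 1 y, \<phi> 2 y, \<phi> 3 y}"
proof -
  obtain a b c where *: "a < b" "b < c" "{x. R x = y} = {a, b, c}"
    using R_three_solutions[OF assms] by blast
  have "sorted_list_of_set {a, b, c} = [a, b, c]"
    using sorted_list_of_set.idem_if_sorted_distinct[of "[a, b, c]"] * by simp
  then show "\<phi> 1 y < \<phi> 2 y" "\<phi> 2 y < \<phi> 3 y" "{x. R x = y} = {\<phi> 1 y, \<phi> 2 y, \<phi> 3 y}"
    using * by (auto simp: \<phi>_def)
qed

lemma pt_inject [simp]: "pt m n = pt m n' \<longleftrightarrow> n = n'"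
  by (simp add: pt_def)

lemma pow5_factor_unique:
  fixes q q' :: nat
  assumes "5 ^ k * q = 5 ^ k' * q'" "\<not> 5 dvd q" "\<not> 5 dvd q'"
  shows "k = k' \<and> q = q'"
proof -
  have *: "k' \<le> k" if "5 ^ k * q = 5 ^ k' * q'" "\<not> 5 dvd q" for k k' and q q' :: nat
  proof (rule ccontr)
    assume "\<not> k' \<le> k"
    then obtain d where "k' = k + Suc d" by (metis add_Suc_right less_imp_Suc_add not_le)
    then have "q = 5 * (5 ^ d * q')" using that by (simp add: power_add)
    with that show False by simp
  qed
  have "k = k'" using *[of k q k' q'] *[of k' q' k q] assms by simp
  then show ?thesis using assms by simp
qed

lemma ident_unique:
  assumes "x \<in> points m"
  shows "\<exists>!y. ident m x y"
proof -
  define p :: "nat \<Rightarrow> nat" where "p q = (if odd (q mod 5) then q + 1 else q - 1)" for q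
  have repr: "ident m x y \<longleftrightarrow> x \<in> points m \<and> y \<in> points m \<and>
      (\<exists>k q. \<not> 5 dvd q \<and> x = pt m (5 ^ k * q) \<and> y = pt m (5 ^ k * p q))" for x y
  proof -
    have *: "(\<exists>j. {x, y} = {pt m (5 ^ k * (1 + 5 * j)), pt m (5 ^ k * (2 + 5 * j))} \<or>
            {x, y} = {pt m (5 ^ k * (3 + 5 * j)), pt m (5 ^ k * (4 + 5 * j))}) \<longleftrightarrow>
          (\<exists>q. \<not> 5 dvd q \<and> x = pt m (5 ^ k * q) \<and> y = pt m (5 ^ k * p q))" (is "?L \<longleftrightarrow> ?R") for k
    proof
      assume ?L
      then obtain j where "(x = pt m (5 ^ k * (1 + 5 * j)) \<and> y = pt m (5 ^ k * (2 + 5 * j))) \<or>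
          (x = pt m (5 ^ k * (2 + 5 * j)) \<and> y = pt m (5 ^ k * (1 + 5 * j))) \<or>
          (x = pt m (5 ^ k * (3 + 5 * j)) \<and> y = pt m (5 ^ k * (4 + 5 * j))) \<or>
          (x = pt m (5 ^ k * (4 + 5 * j)) \<and> y = pt m (5 ^ k * (3 + 5 * j)))"
        unfolding doubleton_eq_iff by blast
      then have "\<exists>a\<in>{1, 2, 3, 4}. x = pt m (5 ^ k * (a + 5 * j)) \<and>
          y = pt m (5 ^ k * ((if odd a then a + 1 else a - 1) + 5 * j))"
        by (elim disjE) simp_all
      then obtain a where a: "a \<in> {1, 2, 3, 4}" "x = pt m (5 ^ k * (a + 5 * j))"
          "y = pt m (5 ^ k * ((if odd a then a + 1 else a - 1) + 5 * j))" by blast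
      moreover from a(1) have a15: "1 \<le> a" "a < 5" by auto
      then have a5: "(a + 5 * j) mod 5 = a" by simp
      with a15 have "\<not> 5 dvd a + 5 * j" by (metis dvd_eq_mod_eq_0 not_one_le_zero)
      moreover have "p (a + 5 * j) = (if odd a then a + 1 else a - 1) + 5 * j"
        using a15 unfolding p_def a5 by simp
      ultimately show ?R by metis
    next
      assume ?R
      then obtain q where q: "\<not> 5 dvd q" "x = pt m (5 ^ k * q)" "y = pt m (5 ^ k * p q)" by blast
      define j where "j = q div 5"
      have "q mod 5 = 1 \<or> q mod 5 = 2 \<or> q mod 5 = 3 \<or> q mod 5 = 4"
        using q(1) by (simp add: dvd_eq_mod_eq_0) linarith
      moreover have "q = q mod 5 + 5 * j" by (simp add: j_def)
      ultimately have "(q = 1 + 5 * j \<and> p q = 2 + 5 * j) \<or> (q = 2 + 5 * j \<and> p q = 1 + 5 * j) \<or>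
          (q = 3 + 5 * j \<and> p q = 4 + 5 * j) \<or> (q = 4 + 5 * j \<and> p q = 3 + 5 * j)"
        by (elim disjE) (simp_all add: p_def)
      then show ?L
        unfolding q(2,3) by (intro exI[of _ j]) (elim disjE conjE; simp add: doubleton_eq_iff)
    qed
    show ?thesis unfolding ident_def * ..
  qed
  obtain n where n: "x = pt m n" "1 \<le> n" "n \<le> 2 * 5 ^ m"
    using assms by (auto simp: points_def)
  have "\<exists>k q. n = 5 ^ k * q \<and> \<not> 5 dvd q" using n(2)
  proof (induction n rule: less_induct)
    case (less n)
    show ?case
    proof (cases "5 dvd n")
      case True
      then obtain n' where n': "n = 5 * n'" by blast
      then obtain k q where "n' = 5 ^ k * q" "\<not> 5 dvd q"
        using less.IH[of n'] less.prems by auto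
      then show ?thesis using n' by (intro exI[of _ "Suc k"] exI[of _ q]) simp
    qed (auto intro: exI[of _ 0])
  qed
  then obtain k q where kq: "n = 5 ^ k * q" "\<not> 5 dvd q" by blast
  have q1: "1 \<le> q" using kq(2) by (cases q) auto
  have "k \<le> m"
  proof (rule ccontr)
    assume "\<not> k \<le> m"
    then have "(5::nat) ^ Suc m \<le> 5 ^ k" by (intro power_increasing) auto
    also have "\<dots> \<le> 5 ^ k * q" using q1 by simp
    finally have "(5::nat) * 5 ^ m \<le> 2 * 5 ^ m" using n kq by simp
    then show False by simp
  qed
  then obtain d where d: "m = k + d" using le_Suc_ex by blast
  have "5 ^ k * q \<le> 5 ^ k * (2 * 5 ^ d)"
    using n(3) kq(1) by (simp add: d power_add mult.left_commute)
  then have qd: "q \<le> 2 * 5 ^ d" by simp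
  have pq: "1 \<le> p q \<and> p q \<le> 2 * 5 ^ d"
  proof (cases d)
    case 0
    then have "q = 1 \<or> q = 2" using qd q1 by auto
    then show ?thesis using 0 by (auto simp: p_def)
  next
    case (Suc d')
    define t :: nat where "t = 2 * 5 ^ d'"
    have "q \<le> 5 * t" using qd by (simp add: Suc t_def)
    moreover have "q \<noteq> 5 * t" using kq(2) by auto
    moreover have "q \<noteq> 1" if "even (q mod 5)" using that by auto
    ultimately have "1 \<le> p q \<and> p q \<le> 5 * t" using q1 unfolding p_def by auto
    then show ?thesis by (simp add: Suc t_def)
  qed
  have "5 ^ k * p q \<le> 5 ^ k * (2 * 5 ^ d)" using pq by simp
  then have "5 ^ k * p q \<in> {1..2 * 5 ^ m}"
    using pq by (simp add: d power_add mult.left_commute)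
  then have "pt m (5 ^ k * p q) \<in> points m" unfolding points_def by blast
  then have "ident m x (pt m (5 ^ k * p q))" unfolding repr using assms n kq by blast
  moreover have "y = pt m (5 ^ k * p q)" if y: "ident m x y" for y
  proof -
    obtain k' q' where k': "\<not> 5 dvd q'" "x = pt m (5 ^ k' * q')" "y = pt m (5 ^ k' * p q')"
      using y unfolding repr by blast
    then have "k' = k \<and> q' = q" using n kq by (intro pow5_factor_unique) auto
    then show ?thesis using k' by simp
  qed
  ultimately show ?thesis by blast
qed

end

theory Submission
  imports Defs
begin

text \<open>
  An arc between two consecutive old points \<open>5 j\<close> and \<open>5 (j + 1)\<close> of level \<open>m + 1\<close> carries just two
  new vertices, \<open>5 j + 1 \<sim> 5 j + 2\<close> and \<open>5 j + 3 \<sim> 5 j + 4\<close>. Write \<open>a, p, q, b\<close> for the values of a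
  function at the old point, the two new vertices and the next old point. Each new vertex has a loop,
  so the eigenvalue equations there are \<open>(2 - l) p = a + q\<close> and \<open>(2 - l) q = p + b\<close>, a system with
  determinant \<open>(2 - l)\<^sup>2 - 1 = (1 - l) (3 - l)\<close>.

  If \<open>l\<close> is neither \<open>1\<close> nor \<open>3\<close>, then \<open>p\<close> and \<open>q\<close> are determined by \<open>a\<close> and \<open>b\<close>. Substituting them turns
  the eigenvalue equation at the old vertices into the eigenvalue equation on level \<open>m\<close> for \<open>R l\<close>
  (\<open>old_equation_iff\<close>). So restriction to the old points is an isomorphism from the eigenspace of \<open>l\<close>
  on level \<open>m + 1\<close> onto that of \<open>R l\<close> on level \<open>m\<close>. The bound \<open>4 + sqrt 2\<close> follows by induction on
  \<open>m\<close>, because it is a fixed point of \<open>R\<close> beyond which \<open>R x > x\<close>.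

  If \<open>l\<close> is \<open>1\<close> or \<open>3\<close>, solvability on the arcs forces \<open>b = (l - 2) a\<close>. For \<open>l = 1\<close> the old values
  alternate in sign, but the points \<open>1\<close> and \<open>2\<close> of level \<open>m\<close> are identified; for \<open>l = 3\<close> they are
  constant, and summing the equations over all old vertices gives \<open>0\<close>. Hence these
  eigenfunctions are born on level \<open>m + 1\<close> (\<open>eigenspace_1_3_vanishes\<close>). On each arc they
  satisfy \<open>q = (2 - l) p\<close>, so they are functions on the \<open>2 \<cdot> 5\<^sup>m\<close> edges of the graph of level \<open>m\<close>,
  and the equations at the old vertices say that they lie in the kernel of its incidence matrix,
  unsigned for \<open>l = 1\<close> and signed for \<open>l = 3\<close> (\<open>eigenspace_eq_kernel\<close>). The unsigned
  matrix has full rank \<open>5\<^sup>m\<close> since the graph is connected with an odd closed walk, and the signed one has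
  rank \<open>5\<^sup>m - 1\<close> since the graph is connected; rank-nullity gives the multiplicities.
\<close>

section \<open>Linear algebra in function spaces\<close>

text \<open>
  Only the subspace \<open>S\<close> has finite dimension here, because the functions on a graph live
  in the infinite-dimensional space of all real functions. A basis \<open>B\<close> of the kernel is extended to a basis \<open>C\<close>
  of \<open>S\<close>, and \<open>f\<close> maps \<open>C - B\<close> bijectively to a basis of the image.
\<close>

lemma finite_dimensional_rank_nullity:
  fixes s1 :: "'a::field \<Rightarrow> 'b::ab_group_add \<Rightarrow> 'b" and s2 :: "'a \<Rightarrow> 'c::ab_group_add \<Rightarrow> 'c"
  assumes "Vector_Spaces.linear s1 s2 f" and S: "module.subspace s1 S"
    and fin: "finite F" "S \<subseteq> module.span s1 F"
  shows "vector_space.dim s2 (f ` S) + vector_space.dim s1 {x \<in> S. f x = 0} = vector_space.dim s1 S"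
proof -
  interpret Vector_Spaces.linear s1 s2 f by fact
  let ?K = "{x \<in> S. f x = 0}"
  have K: "vs1.subspace ?K"
    using S by (auto simp: vs1.subspace_def add scale)
  obtain B where B: "B \<subseteq> ?K" "vs1.independent B" "?K \<subseteq> vs1.span B"
    using vs1.maximal_independent_subset by blast
  have BS: "B \<subseteq> S" using B by blast
  obtain C where C: "B \<subseteq> C" "C \<subseteq> S" "vs1.independent C" "S \<subseteq> vs1.span C"
    using vs1.maximal_independent_subset_extend[OF BS B(2)] by blast
  have finC: "finite C"
    using vs1.independent_span_bound[OF fin(1) C(3)] C(2) fin(2) by blast
  have finB: "finite B" using finC C(1) finite_subset by blast
  define D where "D = C - B"
  have indD: "vs1.independent D" unfolding D_def using C(3) vs1.independent_mono by blast
  have DS: "vs1.span D \<subseteq> S"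
    using C(2) S by (intro vs1.span_minimal) (auto simp: D_def)
  have "x = 0" if x: "x \<in> vs1.span D" "f x = 0" for x
  proof -
    have "x \<in> ?K" using x DS by blast
    then have "x \<in> vs1.span B" using B(3) by blast
    then obtain r where r: "x = (\<Sum>b\<in>B. s1 (r b) b)" using vs1.span_finite[OF finB] by auto
    obtain t where t: "x = (\<Sum>d\<in>D. s1 (t d) d)"
      using x(1) vs1.span_finite[of D] finC by (auto simp: D_def)
    define w where "w c = (if c \<in> B then r c else - t c)" for c
    have "(\<Sum>c\<in>C. s1 (w c) c) = (\<Sum>c\<in>D. s1 (w c) c) + (\<Sum>c\<in>B. s1 (w c) c)"
      unfolding D_def by (rule sum.subset_diff[OF C(1) finC])
    also have "(\<Sum>c\<in>B. s1 (w c) c) = x" unfolding r by (intro sum.cong) (auto simp: w_def)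
    also have "(\<Sum>c\<in>D. s1 (w c) c) = - x" unfolding t sum_negf [symmetric]
      by (intro sum.cong) (auto simp: w_def D_def)
    finally have "(\<Sum>c\<in>C. s1 (w c) c) = 0" by simp
    then have "w c = 0" if "c \<in> C" for c
      using vs1.independentD[OF C(3) finC subset_refl] that by blast
    then have "r b = 0" if "b \<in> B" for b using that C(1) w_def[of b] by (metis subsetD)
    then show ?thesis unfolding r by simp
  qed
  then have inj: "inj_on f (vs1.span D)"
    using inj_on_iff_eq_0[OF vs1.subspace_span] by blast
  have injD: "inj_on f D" by (rule inj_on_subset[OF inj vs1.span_superset])
  have indf: "vs2.independent (f ` D)"
    using indD inj dependent_inj_imageD by blast
  have "f ` S \<subseteq> vs2.span (f ` D)"
  proof -
    have "f ` S \<subseteq> vs2.span (f ` C)"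
      using C(4) by (auto simp: span_image)
    also have "\<dots> \<subseteq> vs2.span (f ` D)"
    proof (rule vs2.span_minimal)
      show "f ` C \<subseteq> vs2.span (f ` D)"
      proof
        fix y assume "y \<in> f ` C"
        then obtain c where c: "c \<in> C" "y = f c" by blast
        show "y \<in> vs2.span (f ` D)"
        proof (cases "c \<in> B")
          case True
          then have "y = 0" using B(1) c by blast
          then show ?thesis by (simp add: vs2.span_zero)
        next
          case False
          then show ?thesis using c by (auto simp: D_def intro!: vs2.span_base)
        qed
      qed
    qed simp
    finally show ?thesis .
  qed
  moreover have "f ` D \<subseteq> f ` S" using C(2) by (auto simp: D_def)
  ultimately have "vs2.dim (f ` S) = card D"
    using vs2.dim_unique[OF _ _ indf] card_image[OF injD] by blast
  moreover have "vs1.dim ?K = card B" using vs1.dim_unique[OF B(1,3,2)] by blast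
  moreover have "vs1.dim S = card C" using vs1.dim_unique[OF C(2,4,3)] by blast
  moreover have "card C = card D + card B"
    unfolding D_def using finC C(1) finB by (metis card_Diff_subset card_mono le_add_diff_inverse2)
  ultimately show ?thesis by simp
qed

lemma scale_fun_apply [simp]: "scale_fun c u x = c * u x"
  by (simp add: scale_fun_def)

lemma sum_fun_apply: "(\<Sum>i\<in>I. f i) x = (\<Sum>i\<in>I. f i x)"
  by (induction I rule: infinite_finite_induct) auto

lemma linear_scale_funI:
  "Vector_Spaces.linear scale_fun scale_fun f" if "\<And>u v. f (u + v) = f u + f v" "\<And>c u. f (scale_fun c u) = scale_fun c (f u)"
  unfolding Vector_Spaces.linear_iff by (intro conjI allI real_functions.vector_space_axioms that)

text \<open>
  Function spaces with an explicit basis are counted this way: functions \<open>b i\<close> dual to evaluation at points \<open>a i\<close> form a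
  basis as soon as these evaluations separate the functions in the subspace, since
  \<open>v - (\<Sum>i. v (a i) * b i)\<close> vanishes at all the points.
\<close>

lemma dual_evaluation_basis:
  fixes b :: "'i \<Rightarrow> real \<Rightarrow> real" and a :: "'i \<Rightarrow> real"
  assumes S: "real_functions.subspace S" and fin: "finite I"
    and b: "\<And>i. i \<in> I \<Longrightarrow> b i \<in> S"
    and dual: "\<And>i k. i \<in> I \<Longrightarrow> k \<in> I \<Longrightarrow> b i (a k) = (if i = k then 1 else 0)"
    and zero: "\<And>v. v \<in> S \<Longrightarrow> (\<And>k. k \<in> I \<Longrightarrow> v (a k) = 0) \<Longrightarrow> v = 0"
  shows "real_functions.dim S = card I" "S \<subseteq> real_functions.span (b ` I)"
proof -
  have inj: "inj_on b I"
  proof (rule inj_onI)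
    fix i k assume "i \<in> I" "k \<in> I" "b i = b k"
    then show "i = k" using dual[of i i] dual[of k i] by (metis zero_neq_one)
  qed
  have ev: "(\<Sum>i\<in>I. scale_fun (c i) (b i)) (a k) = c k" if "k \<in> I" for c k
  proof -
    have "(\<Sum>i\<in>I. scale_fun (c i) (b i)) (a k) = (\<Sum>i\<in>I. if i = k then c i else 0)"
      unfolding sum_fun_apply using that by (intro sum.cong) (auto simp: dual)
    then show ?thesis using that fin by simp
  qed
  show span: "S \<subseteq> real_functions.span (b ` I)"
  proof
    fix v assume v: "v \<in> S"
    let ?w = "\<Sum>i\<in>I. scale_fun (v (a i)) (b i)"
    have "v - ?w = 0"
    proof (rule zero)
      show "v - ?w \<in> S"
        using v b S by (intro real_functions.subspace_diff real_functions.subspace_sum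
            real_functions.subspace_scale)
      show "(v - ?w) (a k) = 0" if "k \<in> I" for k using ev[OF that, of "\<lambda>i. v (a i)"] by simp
    qed
    then have "v = ?w" by simp
    moreover have "?w \<in> real_functions.span (b ` I)"
      by (intro real_functions.span_sum real_functions.span_scale real_functions.span_base imageI)
    ultimately show "v \<in> real_functions.span (b ` I)" by simp
  qed
  have "real_functions.independent (b ` I)"
  proof (rule real_functions.independent_if_scalars_zero)
    show "finite (b ` I)" using fin by simp
    fix f x assume f: "(\<Sum>x\<in>b ` I. scale_fun (f x) x) = 0" and x: "x \<in> b ` I"
    then obtain k where k: "k \<in> I" "x = b k" by blast
    have "(\<Sum>i\<in>I. scale_fun (f (b i)) (b i)) = 0"
      using f by (simp add: sum.reindex[OF inj])
    then show "f x = 0" using ev[OF k(1), of "\<lambda>i. f (b i)"] k by simp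
  qed
  then show "real_functions.dim S = card I"
    using real_functions.dim_unique[OF _ span _ card_image[OF inj]] b by blast
qed

section \<open>Integer coordinates on the circle\<close>

text \<open>
  Numbering the points by all integers, with period \<open>2 * 5 ^ m\<close>, makes rotation of the circle
  addition of integers, so that no point needs a separate treatment at the place where the circle was cut.
\<close>

definition circ :: "nat \<Rightarrow> int \<Rightarrow> real" where
  "circ m n = wrap (of_int n / (2 * 5 ^ m))"

text \<open>
  The contribution of one point of an identified pair to the sum over the neighbours of the vertex.
\<close>

definition circle_nbrs :: "nat \<Rightarrow> (real \<Rightarrow> real) \<Rightarrow> real \<Rightarrow> real" where
  "circle_nbrs m u x = u (wrap (x + 1 / (2 * 5 ^ m))) + u (wrap (x - 1 / (2 * 5 ^ m)))"

lemma wrap_shift: "wrap (t + of_int k) = wrap t"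
  by (simp add: wrap_def)

lemma wrap_eq_self: "0 < t \<Longrightarrow> t \<le> 1 \<Longrightarrow> wrap t = t"
  using ceiling_unique[of 1 t] by (simp add: wrap_def)

lemma wrap_wrap_add: "wrap (wrap t + s) = wrap (t + s)"
proof -
  have "wrap t + s = (t + s) + of_int (1 - \<lceil>t\<rceil>)" by (simp add: wrap_def)
  then show ?thesis by (simp only: wrap_shift)
qed

lemma wrap_eq_iff: "wrap s = wrap t \<longleftrightarrow> (\<exists>k. s = t + of_int k)"
proof
  assume "wrap s = wrap t"
  then have "s = t + of_int (\<lceil>s\<rceil> - \<lceil>t\<rceil>)" by (simp add: wrap_def)
  then show "\<exists>k. s = t + of_int k" by blast
qed (auto simp: wrap_shift)

lemma circ_eq_iff: "circ m n = circ m n' \<longleftrightarrow> 2 * 5 ^ m dvd n - n'"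
proof -
  have "real_of_int n / (2 * 5 ^ m) = real_of_int n' / (2 * 5 ^ m) + real_of_int k
      \<longleftrightarrow> n = n' + 2 * 5 ^ m * k" for k
  proof -
    have "real_of_int n / (2 * 5 ^ m) = real_of_int n' / (2 * 5 ^ m) + real_of_int k
        \<longleftrightarrow> real_of_int n = real_of_int (n' + 2 * 5 ^ m * k)"
      by (simp add: field_simps)
    then show ?thesis by (simp only: of_int_eq_iff)
  qed
  then show ?thesis
    unfolding circ_def wrap_eq_iff by (auto simp: dvd_def algebra_simps)
qed

lemma circ_add_period: "circ m (n + 2 * 5 ^ m * k) = circ m n"
  by (simp add: circ_eq_iff)

lemma circ_eq_pt: "1 \<le> n \<Longrightarrow> n \<le> 2 * 5 ^ m \<Longrightarrow> circ m (int n) = pt m n"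
proof -
  assume "1 \<le> n" "n \<le> 2 * 5 ^ m"
  then have "0 < real n / (2 * 5 ^ m)" "real n \<le> real (2 * 5 ^ m)"
    by (auto simp del: of_nat_mult of_nat_power)
  then show ?thesis by (simp add: circ_def pt_def wrap_eq_self)
qed

lemma points_circ_image: "points m = circ m ` {1..2 * 5 ^ m}"
proof -
  have "points m = (\<lambda>n. circ m (int n)) ` {1..2 * 5 ^ m}"
    unfolding points_def by (intro image_cong) (auto simp: circ_eq_pt)
  also have "\<dots> = circ m ` (int ` {1..2 * 5 ^ m})" by (simp add: image_image)
  also have "int ` {1..2 * 5 ^ m} = {1..2 * 5 ^ m}" by (simp add: image_int_atLeastAtMost)
  finally show ?thesis .
qed

lemma circ_in_points [simp]: "circ m n \<in> points m"
proof -
  define r where "r = (n - 1) mod (2 * 5 ^ m) + 1"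
  have "0 \<le> (n - 1) mod (2 * 5 ^ m)" "(n - 1) mod (2 * 5 ^ m) < 2 * 5 ^ m" by simp_all
  then have r: "1 \<le> r" "r \<le> 2 * 5 ^ m" unfolding r_def by linarith+
  have "2 * 5 ^ m dvd (n - 1) mod (2 * 5 ^ m) - (n - 1)"
    by (simp add: mod_eq_dvd_iff [symmetric])
  then have "circ m r = circ m n" by (simp add: circ_eq_iff r_def algebra_simps)
  then show ?thesis using r unfolding points_circ_image by (metis atLeastAtMost_iff imageI)
qed

lemma points_eq_range: "points m = range (circ m)"
  using circ_in_points points_circ_image by blast

lemma pointsE: assumes "x \<in> points m" obtains n where "x = circ m n"
  using assms by (auto simp: points_eq_range)

lemma card_points: "card (points m) = 2 * 5 ^ m"
  unfolding points_def by (simp add: card_image inj_on_def)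

lemma finite_points [simp]: "finite (points m)"
  by (simp add: points_def)

lemma circ_Suc_mult5: "circ (Suc m) (5 * n) = circ m n"
  by (simp add: circ_def)

lemma points_subset: "points m \<subseteq> points (Suc m)"
proof
  fix x assume "x \<in> points m"
  then obtain n where "x = circ m n" by (rule pointsE)
  then have "x = circ (Suc m) (5 * n)" by (simp add: circ_Suc_mult5)
  then show "x \<in> points (Suc m)" by simp
qed

lemma wrap_circ_add: "wrap (circ m n + of_int k / (2 * 5 ^ m)) = circ m (n + k)"
  by (simp add: circ_def wrap_wrap_add add_divide_distrib)

lemma circle_nbrs_circ: "circle_nbrs m u (circ m n) = u (circ m (n + 1)) + u (circ m (n - 1))"
  using wrap_circ_add[of m n 1] wrap_circ_add[of m n "-1"] by (simp add: circle_nbrs_def)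

lemma circle_nbrs_old:
  "circle_nbrs (Suc m) u (circ m n) = u (circ (Suc m) (5 * n + 1)) + u (circ (Suc m) (5 * n - 1))"
  using circle_nbrs_circ[of "Suc m" u "5 * n"] by (simp add: circ_Suc_mult5)

lemma neg_laplacian_eq:
  "neg_laplacian m u x = 4 * u x - circle_nbrs m u x - circle_nbrs m u (mate m x)"
  by (simp add: neg_laplacian_def neighbours_def Let_def circle_nbrs_def)

lemma circ_Suc_cases:
  obtains j where "n = 5 * j" | j where "n = 5 * j + 1" | j where "n = 5 * j + 2"
  | j where "n = 5 * j + 3" | j where "n = 5 * j + (4::int)"
proof -
  have "n mod 5 = 0 \<or> n mod 5 = 1 \<or> n mod 5 = 2 \<or> n mod 5 = 3 \<or> n mod 5 = 4" by presburger
  moreover have "n = 5 * (n div 5) + n mod 5" by simp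
  ultimately show thesis using that[of "n div 5"] by (elim disjE) simp_all
qed

section \<open>Identified pairs on consecutive levels\<close>

lemma ident_mate: "x \<in> points m \<Longrightarrow> ident m x (mate m x)"
  unfolding mate_def by (rule theI'[OF ident_unique])

lemma ident_points: "ident m x y \<Longrightarrow> x \<in> points m \<and> y \<in> points m"
  by (simp add: ident_def)

lemma mate_eqI: "ident m x y \<Longrightarrow> mate m x = y"
  using ident_unique ident_mate ident_points by blast

lemma ident_sym: "ident m x y \<Longrightarrow> ident m y x"
  by (auto simp: ident_def insert_commute)

lemma mate_in_points [simp]: "x \<in> points m \<Longrightarrow> mate m x \<in> points m"
  using ident_mate ident_points by blast

lemma mate_mate [simp]: "x \<in> points m \<Longrightarrow> mate m (mate m x) = x"
  by (rule mate_eqI[OF ident_sym[OF ident_mate]])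

lemma mate_neq: "x \<in> points m \<Longrightarrow> mate m x \<noteq> x"
  using ident_mate[of x m] by (auto simp: ident_def doubleton_eq_iff)

lemma ident_Suc: assumes "ident m x y" shows "ident (Suc m) x y"
proof -
  have *: "pt m (5 ^ k * n) = pt (Suc m) (5 ^ Suc k * n)" for k n by (simp add: pt_def)
  from assms obtain k j where
    "{x, y} = {pt m (5 ^ k * (1 + 5 * j)), pt m (5 ^ k * (2 + 5 * j))} \<or>
     {x, y} = {pt m (5 ^ k * (3 + 5 * j)), pt m (5 ^ k * (4 + 5 * j))}"
    and xy: "x \<in> points m" "y \<in> points m"
    unfolding ident_def by blast
  then have "{x, y} = {pt (Suc m) (5 ^ Suc k * (1 + 5 * j)), pt (Suc m) (5 ^ Suc k * (2 + 5 * j))} \<or>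
     {x, y} = {pt (Suc m) (5 ^ Suc k * (3 + 5 * j)), pt (Suc m) (5 ^ Suc k * (4 + 5 * j))}"
    by (simp only: *)
  moreover have "x \<in> points (Suc m)" "y \<in> points (Suc m)" using xy points_subset by auto
  ultimately show ?thesis unfolding ident_def by blast
qed

lemma mate_Suc_old: "x \<in> points m \<Longrightarrow> mate (Suc m) x = mate m x"
  by (rule mate_eqI[OF ident_Suc[OF ident_mate]])

text \<open>
  The identifications with \<open>k = 0\<close>. An integer \<open>j\<close> is first reduced to a natural number below
  the period, for which the points have the form used in the definition of the identifications.
\<close>

lemma ident_new:
  "ident (Suc m) (circ (Suc m) (5 * j + 1)) (circ (Suc m) (5 * j + 2))"
  "ident (Suc m) (circ (Suc m) (5 * j + 3)) (circ (Suc m) (5 * j + 4))"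
proof -
  define i where "i = nat (j mod (2 * 5 ^ m))"
  have "0 \<le> j mod (2 * 5 ^ m)" "j mod (2 * 5 ^ m) < 2 * 5 ^ m" by simp_all
  then have i: "int i = j mod (2 * 5 ^ m)" "i < 2 * 5 ^ m"
    by (simp_all add: i_def nat_less_iff)
  have *: "circ (Suc m) (5 * j + int r) = pt (Suc m) (5 ^ 0 * (r + 5 * i))"
    if "r \<in> {1,2,3,4}" for r
  proof -
    have "circ (Suc m) (5 * j + int r) = circ (Suc m) (int (r + 5 * i) + 2 * 5 ^ Suc m * (j div (2 * 5 ^ m)))"
    proof -
      define K where "K = 2 * 5 ^ m * (j div (2 * 5 ^ m))"
      have "j = int i + K" unfolding i K_def by (simp only: mod_mult_div_eq)
      moreover have "2 * 5 ^ Suc m * (j div (2 * 5 ^ m)) = 5 * K" by (simp add: K_def)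
      ultimately have "5 * j + int r = int (r + 5 * i) + 2 * 5 ^ Suc m * (j div (2 * 5 ^ m))"
        by linarith
      then show ?thesis by (simp only:)
    qed
    also have "\<dots> = pt (Suc m) (r + 5 * i)"
      unfolding circ_add_period using i(2) that by (intro circ_eq_pt) auto
    finally show ?thesis by simp
  qed
  have e: "circ (Suc m) (5 * j + 1) = pt (Suc m) (5 ^ 0 * (1 + 5 * i))"
    "circ (Suc m) (5 * j + 2) = pt (Suc m) (5 ^ 0 * (2 + 5 * i))"
    "circ (Suc m) (5 * j + 3) = pt (Suc m) (5 ^ 0 * (3 + 5 * i))"
    "circ (Suc m) (5 * j + 4) = pt (Suc m) (5 ^ 0 * (4 + 5 * i))"
    using *[of 1] *[of 2] *[of 3] *[of 4] by simp_all
  note p = circ_in_points[of "Suc m" "5 * j + 1"] circ_in_points[of "Suc m" "5 * j + 2"]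
    circ_in_points[of "Suc m" "5 * j + 3"] circ_in_points[of "Suc m" "5 * j + 4"]
  show "ident (Suc m) (circ (Suc m) (5 * j + 1)) (circ (Suc m) (5 * j + 2))"
    using p unfolding ident_def e by blast
  show "ident (Suc m) (circ (Suc m) (5 * j + 3)) (circ (Suc m) (5 * j + 4))"
    using p unfolding ident_def e by blast
qed

lemma mate_new:
  "mate (Suc m) (circ (Suc m) (5 * j + 1)) = circ (Suc m) (5 * j + 2)"
  "mate (Suc m) (circ (Suc m) (5 * j + 2)) = circ (Suc m) (5 * j + 1)"
  "mate (Suc m) (circ (Suc m) (5 * j + 3)) = circ (Suc m) (5 * j + 4)"
  "mate (Suc m) (circ (Suc m) (5 * j + 4)) = circ (Suc m) (5 * j + 3)"
  by (rule mate_eqI, rule ident_new ident_sym[OF ident_new(1)] ident_sym[OF ident_new(2)])+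

text \<open>
  These two points are adjacent on the circle, so their vertex has a loop, a closed walk of odd length. It
  rules out functions on the vertices that alternate in sign along the edges.
\<close>

lemma mate_circ_1: "mate m (circ m 1) = circ m 2"
proof -
  have e: "circ m 1 = pt m (5 ^ 0 * (1 + 5 * 0))" "circ m 2 = pt m (5 ^ 0 * (2 + 5 * 0))"
    using circ_eq_pt[of 1 m] circ_eq_pt[of 2 m] by simp_all
  have "ident m (circ m 1) (circ m 2)"
    using circ_in_points[of m 1] circ_in_points[of m 2] unfolding ident_def e by blast
  then show ?thesis by (rule mate_eqI)
qed

lemma graph_functions_iff:
  "u \<in> graph_functions m \<longleftrightarrow>
     (\<forall>x. x \<notin> points m \<longrightarrow> u x = 0) \<and> (\<forall>x\<in>points m. u (mate m x) = u x)"
proof -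
  have "ident m x y \<longleftrightarrow> x \<in> points m \<and> y = mate m x" for x y
    using ident_mate[of x m] mate_eqI[of m x y] ident_points[of m x y] by metis
  then have "(\<forall>x y. ident m x y \<longrightarrow> u x = u y) \<longleftrightarrow> (\<forall>x\<in>points m. u (mate m x) = u x)"
    by metis
  then show ?thesis unfolding graph_functions_def by blast
qed

text \<open>
  Pairs of new points are the pairs inside the arcs, and pairs of old points are inherited from
  level \<open>m\<close>.
\<close>

lemma graph_functions_Suc_iff:
  "v \<in> graph_functions (Suc m) \<longleftrightarrow>
     (\<forall>x. x \<notin> points (Suc m) \<longrightarrow> v x = 0) \<and> (\<forall>x\<in>points m. v (mate m x) = v x) \<and>
     (\<forall>j. v (circ (Suc m) (5 * j + 2)) = v (circ (Suc m) (5 * j + 1)) \<and>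
          v (circ (Suc m) (5 * j + 3)) = v (circ (Suc m) (5 * j + 4)))" (is "?L \<longleftrightarrow> ?R")
proof
  assume ?L
  then have *: "\<forall>x. x \<notin> points (Suc m) \<longrightarrow> v x = 0" "\<forall>x\<in>points (Suc m). v (mate (Suc m) x) = v x"
    by (auto simp: graph_functions_iff)
  have "v (mate m x) = v x" if "x \<in> points m" for x
    using *(2) that points_subset by (metis mate_Suc_old subsetD)
  then show ?R using * mate_new by (metis circ_in_points)
next
  assume R: ?R
  have "v (mate (Suc m) x) = v x" if x: "x \<in> points (Suc m)" for x
  proof -
    obtain n where n: "x = circ (Suc m) n" using x by (rule pointsE)
    show ?thesis
      by (cases n rule: circ_Suc_cases) (use R in \<open>simp_all add: n mate_new circ_Suc_mult5 mate_Suc_old\<close>)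
  qed
  then show ?L using R by (simp add: graph_functions_iff)
qed

section \<open>Functions prescribed arc by arc\<close>

text \<open>
  The index of a point on level \<open>m + 1\<close> is recovered by scaling; it is \<open>5 j\<close> at an old point, and the
  four points \<open>5 j + 1, \<dots>, 5 j + 4\<close> are the new points on the \<open>j\<close>-th arc.
\<close>

definition fill :: "nat \<Rightarrow> (int \<Rightarrow> real) \<Rightarrow> (int \<Rightarrow> real) \<Rightarrow> (int \<Rightarrow> real) \<Rightarrow> real \<Rightarrow> real" where
  "fill m a p q x =
     (if x \<in> points (Suc m) then
        let n = \<lfloor>x * (2 * 5 ^ Suc m)\<rfloor>; j = n div 5
        in if n mod 5 = 0 then a j else if n mod 5 \<le> 2 then p j else q j
      else 0)"

lemma fill_circ:
  assumes per: "\<And>j k. a (j + 2 * 5 ^ m * k) = a j" "\<And>j k. p (j + 2 * 5 ^ m * k) = p j"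
    "\<And>j k. q (j + 2 * 5 ^ m * k) = q j"
  shows "fill m a p q (circ m j) = a j"
    "fill m a p q (circ (Suc m) (5 * j + 1)) = p j" "fill m a p q (circ (Suc m) (5 * j + 2)) = p j"
    "fill m a p q (circ (Suc m) (5 * j + 3)) = q j" "fill m a p q (circ (Suc m) (5 * j + 4)) = q j"
proof -
  have *: "\<exists>k. \<lfloor>circ (Suc m) n * (2 * 5 ^ Suc m)\<rfloor> = n + 5 * (2 * 5 ^ m * k)" for n
  proof -
    define k where "k = 1 - \<lceil>real_of_int n / (2 * 5 ^ Suc m)\<rceil>"
    have "circ (Suc m) n * (2 * 5 ^ Suc m) = of_int (n + 5 * (2 * 5 ^ m * k))"
      by (simp add: circ_def wrap_def k_def field_simps)
    then have "\<lfloor>circ (Suc m) n * (2 * 5 ^ Suc m)\<rfloor> = n + 5 * (2 * 5 ^ m * k)"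
      by (simp only: floor_of_int)
    then show ?thesis ..
  qed
  have **: "fill m a p q (circ (Suc m) (5 * j + r)) = (if r = 0 then a j else if r \<le> 2 then p j else q j)"
    if "0 \<le> r" "r < 5" for r
  proof -
    obtain k where k: "\<lfloor>circ (Suc m) (5 * j + r) * (2 * 5 ^ Suc m)\<rfloor> = 5 * j + r + 5 * (2 * 5 ^ m * k)"
      using * by blast
    have n: "5 * j + r + 5 * (2 * 5 ^ m * k) = r + 5 * (j + 2 * 5 ^ m * k)" by simp
    have "(5 * j + r + 5 * (2 * 5 ^ m * k)) div 5 = j + 2 * 5 ^ m * k"
      "(5 * j + r + 5 * (2 * 5 ^ m * k)) mod 5 = r"
      unfolding n using that by (simp_all only: div_mult_self2 mod_mult_self2) simp_all
    then show ?thesis by (simp only: fill_def circ_in_points if_True k Let_def per)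
  qed
  show "fill m a p q (circ m j) = a j"
    "fill m a p q (circ (Suc m) (5 * j + 1)) = p j" "fill m a p q (circ (Suc m) (5 * j + 2)) = p j"
    "fill m a p q (circ (Suc m) (5 * j + 3)) = q j" "fill m a p q (circ (Suc m) (5 * j + 4)) = q j"
    using **[of 0] **[of 1] **[of 2] **[of 3] **[of 4] by (simp_all add: circ_Suc_mult5)
qed

lemma fill_graph_function:
  assumes u: "u \<in> graph_functions m" and a: "\<And>j. a j = u (circ m j)"
    and per: "\<And>j k. p (j + 2 * 5 ^ m * k) = p j" "\<And>j k. q (j + 2 * 5 ^ m * k) = q j"
  shows "fill m a p q \<in> graph_functions (Suc m)"
proof -
  have pa: "\<And>j k. a (j + 2 * 5 ^ m * k) = a j" by (simp add: a circ_add_period)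
  note f = fill_circ[of a m p q, OF pa per]
  have "fill m a p q (mate m x) = fill m a p q x" if x: "x \<in> points m" for x
  proof -
    obtain n where n: "x = circ m n" using x by (rule pointsE)
    have "mate m x \<in> points m" using x by simp
    then obtain n' where n': "mate m x = circ m n'" by (rule pointsE)
    show ?thesis using u x unfolding n' unfolding n f a
      by (simp add: graph_functions_iff n [symmetric] n' [symmetric])
  qed
  then show ?thesis unfolding graph_functions_Suc_iff by (simp add: f) (simp add: fill_def)
qed

section \<open>Spectral decimation\<close>

lemma neg_laplacian_new:
  assumes v: "v \<in> graph_functions (Suc m)"
  shows "neg_laplacian (Suc m) v (circ (Suc m) (5 * j + 1)) =
      2 * v (circ (Suc m) (5 * j + 1)) - v (circ m j) - v (circ (Suc m) (5 * j + 4))"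
    and "neg_laplacian (Suc m) v (circ (Suc m) (5 * j + 2)) =
      2 * v (circ (Suc m) (5 * j + 1)) - v (circ m j) - v (circ (Suc m) (5 * j + 4))"
    and "neg_laplacian (Suc m) v (circ (Suc m) (5 * j + 3)) =
      2 * v (circ (Suc m) (5 * j + 4)) - v (circ (Suc m) (5 * j + 1)) - v (circ m (j + 1))"
    and "neg_laplacian (Suc m) v (circ (Suc m) (5 * j + 4)) =
      2 * v (circ (Suc m) (5 * j + 4)) - v (circ (Suc m) (5 * j + 1)) - v (circ m (j + 1))"
proof -
  have n: "v (circ (Suc m) (5 * j + 2)) = v (circ (Suc m) (5 * j + 1))"
    "v (circ (Suc m) (5 * j + 3)) = v (circ (Suc m) (5 * j + 4))"
    using v by (simp_all add: graph_functions_Suc_iff)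
  have o: "circ (Suc m) (5 * j) = circ m j" "circ (Suc m) (5 * j + 5) = circ m (j + 1)"
    using circ_Suc_mult5[of m j] circ_Suc_mult5[of m "j + 1"] by (simp_all add: algebra_simps)
  have i: "5 * j + 1 - 1 = 5 * j" "5 * j + 1 + 1 = 5 * j + 2" "5 * j + 2 - 1 = 5 * j + 1"
    "5 * j + 2 + 1 = 5 * j + 3" "5 * j + 3 - 1 = 5 * j + 2" "5 * j + 3 + 1 = 5 * j + 4"
    "5 * j + 4 - 1 = 5 * j + 3" "5 * j + 4 + 1 = 5 * j + 5" by simp_all
  show "neg_laplacian (Suc m) v (circ (Suc m) (5 * j + 1)) =
      2 * v (circ (Suc m) (5 * j + 1)) - v (circ m j) - v (circ (Suc m) (5 * j + 4))"
    "neg_laplacian (Suc m) v (circ (Suc m) (5 * j + 2)) =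
      2 * v (circ (Suc m) (5 * j + 1)) - v (circ m j) - v (circ (Suc m) (5 * j + 4))"
    "neg_laplacian (Suc m) v (circ (Suc m) (5 * j + 3)) =
      2 * v (circ (Suc m) (5 * j + 4)) - v (circ (Suc m) (5 * j + 1)) - v (circ m (j + 1))"
    "neg_laplacian (Suc m) v (circ (Suc m) (5 * j + 4)) =
      2 * v (circ (Suc m) (5 * j + 4)) - v (circ (Suc m) (5 * j + 1)) - v (circ m (j + 1))"
    unfolding neg_laplacian_eq mate_new circle_nbrs_circ i n o by simp_all
qed

text \<open>
  At a new vertex the loop contributes nothing to the Laplacian, which leaves one neighbour on either side,
  and the equations at the two points of a pair coincide. So each arc contributes two equations.
\<close>

lemma eigenspace_Suc_iff:
  "v \<in> eigenspace (Suc m) l \<longleftrightarrow> v \<in> graph_functions (Suc m) \<and>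
     (\<forall>j. (2 - l) * v (circ (Suc m) (5 * j + 1)) = v (circ m j) + v (circ (Suc m) (5 * j + 4)) \<and>
          (2 - l) * v (circ (Suc m) (5 * j + 4)) = v (circ (Suc m) (5 * j + 1)) + v (circ m (j + 1))) \<and>
     (\<forall>x\<in>points m. circle_nbrs (Suc m) v x + circle_nbrs (Suc m) v (mate m x) = (4 - l) * v x)"
proof (cases "v \<in> graph_functions (Suc m)")
  case True
  have n: "v (circ (Suc m) (5 * j + 2)) = v (circ (Suc m) (5 * j + 1))"
    "v (circ (Suc m) (5 * j + 3)) = v (circ (Suc m) (5 * j + 4))" for j
    using True by (simp_all add: graph_functions_Suc_iff)
  have lap: "neg_laplacian (Suc m) v x = 4 * v x - (circle_nbrs (Suc m) v x + circle_nbrs (Suc m) v (mate m x))"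
    if "x \<in> points m" for x
    using that by (simp add: neg_laplacian_eq mate_Suc_old)
  have "(\<forall>x\<in>points (Suc m). neg_laplacian (Suc m) v x = l * v x) \<longleftrightarrow>
      (\<forall>n. neg_laplacian (Suc m) v (circ (Suc m) n) = l * v (circ (Suc m) n))"
    by (simp add: points_eq_range)
  also have "\<dots> \<longleftrightarrow> (\<forall>j. neg_laplacian (Suc m) v (circ m j) = l * v (circ m j)) \<and>
     (\<forall>j. neg_laplacian (Suc m) v (circ (Suc m) (5 * j + 1)) = l * v (circ (Suc m) (5 * j + 1)) \<and>
          neg_laplacian (Suc m) v (circ (Suc m) (5 * j + 4)) = l * v (circ (Suc m) (5 * j + 4)))"
    (is "?L \<longleftrightarrow> ?R")
  proof
    assume ?L
    then show ?R by (metis circ_Suc_mult5)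
  next
    assume R: ?R
    show ?L
    proof
      fix k show "neg_laplacian (Suc m) v (circ (Suc m) k) = l * v (circ (Suc m) k)"
        using R by (cases k rule: circ_Suc_cases)
          (simp_all add: circ_Suc_mult5 n neg_laplacian_new[OF True])
    qed
  qed
  also have "\<dots> \<longleftrightarrow> (\<forall>x\<in>points m. circle_nbrs (Suc m) v x + circle_nbrs (Suc m) v (mate m x) = (4 - l) * v x) \<and>
     (\<forall>j. (2 - l) * v (circ (Suc m) (5 * j + 1)) = v (circ m j) + v (circ (Suc m) (5 * j + 4)) \<and>
          (2 - l) * v (circ (Suc m) (5 * j + 4)) = v (circ (Suc m) (5 * j + 1)) + v (circ m (j + 1)))"
  proof (intro arg_cong2[where f = "(\<and>)"])
    show "(\<forall>j. neg_laplacian (Suc m) v (circ m j) = l * v (circ m j)) \<longleftrightarrow>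
        (\<forall>x\<in>points m. circle_nbrs (Suc m) v x + circle_nbrs (Suc m) v (mate m x) = (4 - l) * v x)"
      unfolding points_eq_range by (auto simp: lap left_diff_distrib) (simp_all add: algebra_simps)
  qed (simp_all add: neg_laplacian_new[OF True] left_diff_distrib, auto simp: algebra_simps)
  finally show ?thesis using True by (auto simp: eigenspace_def)
qed (simp add: eigenspace_def)

definition restrict_old :: "nat \<Rightarrow> (real \<Rightarrow> real) \<Rightarrow> real \<Rightarrow> real" where
  "restrict_old m v x = (if x \<in> points m then v x else 0)"

lemma neg_laplacian_cong:
  assumes "x \<in> points m" "\<And>y. y \<in> points m \<Longrightarrow> u y = v y"
  shows "neg_laplacian m u x = neg_laplacian m v x"
proof -
  have "circle_nbrs m u y = circle_nbrs m v y" if "y \<in> points m" for y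
    using that assms(2) by (auto elim!: pointsE simp: circle_nbrs_circ)
  then show ?thesis using assms by (simp add: neg_laplacian_eq)
qed

lemma square_minus_one_nonzero:
  fixes l :: real assumes "l \<noteq> 1" "l \<noteq> 3" shows "(2 - l)\<^sup>2 - 1 \<noteq> 0"
proof -
  have "(2 - l)\<^sup>2 - 1 = (1 - l) * (3 - l)" by (simp add: power2_eq_square algebra_simps)
  then show ?thesis using assms by simp
qed

text \<open>
  Multiply the equation on the left by the determinant \<open>d = (2 - l)\<^sup>2 - 1\<close>. By Cramer's rule on the two arcs
  at \<open>x\<close>, \<open>d\<close> times the values at the two new neighbours is \<open>2 (2 - l) v x\<close> plus the sum of the values at the
  two neighbours of \<open>x\<close> on level \<open>m\<close>. What remains is the identity
  \<open>4 + 4 (2 - l) - (4 - l) d = R l\<close>.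
\<close>

lemma old_equation_iff:
  assumes v: "v \<in> graph_functions (Suc m)" and l: "l \<noteq> 1" "l \<noteq> 3"
    and new: "\<And>j. (2 - l) * v (circ (Suc m) (5 * j + 1)) = v (circ m j) + v (circ (Suc m) (5 * j + 4))"
      "\<And>j. (2 - l) * v (circ (Suc m) (5 * j + 4)) = v (circ (Suc m) (5 * j + 1)) + v (circ m (j + 1))"
    and x: "x \<in> points m"
  shows "circle_nbrs (Suc m) v x + circle_nbrs (Suc m) v (mate m x) = (4 - l) * v x
    \<longleftrightarrow> neg_laplacian m v x = R l * v x"
proof -
  define d where "d = (2 - l)\<^sup>2 - 1"
  have d: "d \<noteq> 0" unfolding d_def by (rule square_minus_one_nonzero[OF l])
  have nb: "d * circle_nbrs (Suc m) v y = 2 * (2 - l) * v y + circle_nbrs m v y"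
    if y: "y \<in> points m" for y
  proof -
    obtain n where n: "y = circ m n" using y by (rule pointsE)
    have "d * v (circ (Suc m) (5 * n + 1)) = (2 - l) * v (circ m n) + v (circ m (n + 1))"
      using new(1)[of n] new(2)[of n] unfolding d_def power2_eq_square by algebra
    moreover have "d * v (circ (Suc m) (5 * (n - 1) + 4)) = v (circ m (n - 1)) + (2 - l) * v (circ m n)"
      using new(1)[of "n - 1"] new(2)[of "n - 1"] unfolding d_def power2_eq_square
      by simp algebra
    ultimately show ?thesis
      unfolding n circle_nbrs_old circle_nbrs_circ by (simp add: distrib_left algebra_simps)
  qed
  have vx: "v (mate m x) = v x" using v x by (simp add: graph_functions_Suc_iff)
  have "d * (circle_nbrs (Suc m) v x + circle_nbrs (Suc m) v (mate m x) - (4 - l) * v x)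
      = R l * v x - neg_laplacian m v x"
    unfolding neg_laplacian_eq right_diff_distrib distrib_left nb[OF x] nb[OF mate_in_points[OF x]] vx
    by (simp add: d_def R_def power2_eq_square algebra_simps)
  then show ?thesis using d by (metis (no_types) eq_iff_diff_eq_0 mult_eq_0_iff mult_zero_right)
qed

lemma restrict_old_eigenspace:
  assumes v: "v \<in> eigenspace (Suc m) l" and l: "l \<noteq> 1" "l \<noteq> 3"
  shows "restrict_old m v \<in> eigenspace m (R l)"
proof -
  note e = v[unfolded eigenspace_Suc_iff]
  have g: "v \<in> graph_functions (Suc m)" using e by blast
  have "neg_laplacian m v x = R l * v x" if "x \<in> points m" for x
    using old_equation_iff[OF g l _ _ that] e that by blast
  then have "neg_laplacian m (restrict_old m v) x = R l * restrict_old m v x" if "x \<in> points m" for x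
    using that neg_laplacian_cong[OF that, of "restrict_old m v" v] by (simp add: restrict_old_def)
  moreover have "restrict_old m v \<in> graph_functions m"
    using g by (simp add: graph_functions_iff[of _ m] graph_functions_Suc_iff restrict_old_def)
  ultimately show ?thesis by (simp add: eigenspace_def)
qed

lemma graph_function_Suc_eq_0:
  assumes "v \<in> graph_functions (Suc m)" "\<And>x. x \<in> points m \<Longrightarrow> v x = 0"
    "\<And>j. v (circ (Suc m) (5 * j + 1)) = 0" "\<And>j. v (circ (Suc m) (5 * j + 4)) = 0"
  shows "v = 0"
proof
  fix x show "v x = 0 x"
  proof (cases "x \<in> points (Suc m)")
    case True
    then obtain n where "x = circ (Suc m) n" by (rule pointsE)
    then show ?thesis
      by (cases n rule: circ_Suc_cases)
        (use assms in \<open>simp_all add: circ_Suc_mult5 graph_functions_Suc_iff\<close>)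
  qed (use assms in \<open>simp add: graph_functions_iff\<close>)
qed

text \<open>
  With vanishing old values, the system on each arc is homogeneous with nonzero determinant.
\<close>

lemma restrict_old_eq_0D:
  assumes v: "v \<in> eigenspace (Suc m) l" and l: "l \<noteq> 1" "l \<noteq> 3" and r: "restrict_old m v = 0"
  shows "v = 0"
proof -
  note e = v[unfolded eigenspace_Suc_iff]
  have old: "v x = 0" if "x \<in> points m" for x
    using fun_cong[OF r, of x] that by (simp add: restrict_old_def)
  have sq: "((2 - l)\<^sup>2 - 1) * t = (2 - l) * ((2 - l) * t) - t" for t
    by (simp add: power2_eq_square algebra_simps)
  have "((2 - l)\<^sup>2 - 1) * v (circ (Suc m) (5 * j + 1)) = 0"
    "((2 - l)\<^sup>2 - 1) * v (circ (Suc m) (5 * j + 4)) = 0" for j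
  proof -
    have *: "(2 - l) * v (circ (Suc m) (5 * j + 1)) = v (circ (Suc m) (5 * j + 4))"
      "(2 - l) * v (circ (Suc m) (5 * j + 4)) = v (circ (Suc m) (5 * j + 1))"
      using e by (auto simp: old)
    show "((2 - l)\<^sup>2 - 1) * v (circ (Suc m) (5 * j + 1)) = 0"
      unfolding sq * by simp
    show "((2 - l)\<^sup>2 - 1) * v (circ (Suc m) (5 * j + 4)) = 0"
      unfolding sq * by simp
  qed
  then show ?thesis
    using e old square_minus_one_nonzero[OF l] by (intro graph_function_Suc_eq_0[of v m]) auto
qed

text \<open>
  Solve the system on each arc by Cramer's rule; \<open>old_equation_iff\<close> then yields the
  equations at the old vertices.
\<close>

lemma eigenfunction_extension_exists:
  assumes u: "u \<in> eigenspace m (R l)" and l: "l \<noteq> 1" "l \<noteq> 3"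
  shows "\<exists>v\<in>eigenspace (Suc m) l. restrict_old m v = u"
proof -
  define d where "d = (2 - l)\<^sup>2 - 1"
  have d: "d \<noteq> 0" unfolding d_def by (rule square_minus_one_nonzero[OF l])
  define a p q where apq: "a j = u (circ m j)"
    "p j = ((2 - l) * u (circ m j) + u (circ m (j + 1))) / d"
    "q j = (u (circ m j) + (2 - l) * u (circ m (j + 1))) / d" for j
  have c: "circ m (j + 2 * 5 ^ m * k + 1) = circ m (j + 1)" for j k
    using circ_add_period[of m "j + 1" k] by (simp add: algebra_simps)
  have per: "\<And>j k. a (j + 2 * 5 ^ m * k) = a j" "\<And>j k. p (j + 2 * 5 ^ m * k) = p j"
    "\<And>j k. q (j + 2 * 5 ^ m * k) = q j"
    by (simp_all only: apq circ_add_period c)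
  define v where "v = fill m a p q"
  note f = fill_circ[of a m p q, OF per, folded v_def]
  have ug: "u \<in> graph_functions m" using u by (simp add: eigenspace_def)
  have vg: "v \<in> graph_functions (Suc m)"
    unfolding v_def by (rule fill_graph_function[OF ug apq(1) per(2,3)])
  have vu: "v x = u x" if "x \<in> points m" for x
    using that by (auto elim!: pointsE simp: f apq)
  have new: "(2 - l) * v (circ (Suc m) (5 * j + 1)) = v (circ m j) + v (circ (Suc m) (5 * j + 4))"
    "(2 - l) * v (circ (Suc m) (5 * j + 4)) = v (circ (Suc m) (5 * j + 1)) + v (circ m (j + 1))" for j
  proof -
    have "d * ((2 - l) * p j) = d * (a j + q j)" "d * ((2 - l) * q j) = d * (p j + a (j + 1))"
      using d unfolding apq by (simp_all add: field_simps) (simp_all add: d_def power2_eq_square algebra_simps)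
    then show "(2 - l) * v (circ (Suc m) (5 * j + 1)) = v (circ m j) + v (circ (Suc m) (5 * j + 4))"
      "(2 - l) * v (circ (Suc m) (5 * j + 4)) = v (circ (Suc m) (5 * j + 1)) + v (circ m (j + 1))"
      using d by (simp_all add: f)
  qed
  have "neg_laplacian m v x = R l * v x" if "x \<in> points m" for x
    using u that neg_laplacian_cong[OF that vu] vu[OF that] by (simp add: eigenspace_def)
  then have "circle_nbrs (Suc m) v x + circle_nbrs (Suc m) v (mate m x) = (4 - l) * v x"
    if "x \<in> points m" for x
    using old_equation_iff[OF vg l new that] that by blast
  then have "v \<in> eigenspace (Suc m) l"
    using vg new by (simp add: eigenspace_Suc_iff)
  moreover have "restrict_old m v = u"
    using ug vu by (auto simp: fun_eq_iff restrict_old_def graph_functions_iff)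
  ultimately show ?thesis by blast
qed

section \<open>Dimension of the space of functions on the graph\<close>

definition pair_indicator :: "nat \<Rightarrow> real \<Rightarrow> real \<Rightarrow> real" where
  "pair_indicator m x y = (if x \<in> points m \<and> (y = x \<or> y = mate m x) then 1 else 0)"

lemma pair_indicator_in: "pair_indicator m x \<in> graph_functions m"
proof -
  have "mate m y = x \<longleftrightarrow> y = mate m x" "mate m y = mate m x \<longleftrightarrow> y = x"
    if "x \<in> points m" "y \<in> points m" for y
    using that by (metis mate_mate)+
  then show ?thesis by (auto simp: graph_functions_iff pair_indicator_def)
qed

lemma pair_indicator_mate: "x \<in> points m \<Longrightarrow> pair_indicator m (mate m x) = pair_indicator m x"
  by (auto simp: pair_indicator_def fun_eq_iff)

lemma subspace_graph_functions: "real_functions.subspace (graph_functions m)"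
  by (simp add: real_functions.subspace_def graph_functions_iff)

definition pair_reps :: "nat \<Rightarrow> real set" where
  "pair_reps m = {x \<in> points m. x < mate m x}"

lemma points_pair_reps: "points m = pair_reps m \<union> mate m ` pair_reps m"
proof -
  have "x \<in> pair_reps m \<union> mate m ` pair_reps m" if x: "x \<in> points m" for x
  proof (cases "x < mate m x")
    case False
    then have "mate m x \<in> pair_reps m" "x = mate m (mate m x)"
      using mate_neq[OF x] x by (auto simp: pair_reps_def)
    then show ?thesis by blast
  qed (use x in \<open>simp add: pair_reps_def\<close>)
  then show ?thesis by (auto simp: pair_reps_def)
qed

lemma card_pair_reps: "card (pair_reps m) = 5 ^ m"
proof -
  have fin: "finite (pair_reps m)" by (simp add: pair_reps_def)
  have inj: "inj_on (mate m) (pair_reps m)"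
    by (rule inj_on_inverseI[of _ "mate m"]) (simp add: pair_reps_def)
  have "pair_reps m \<inter> mate m ` pair_reps m = {}"
    by (auto simp: pair_reps_def)
  then have "card (points m) = card (pair_reps m) + card (mate m ` pair_reps m)"
    unfolding points_pair_reps[of m] using fin by (intro card_Un_disjoint) auto
  then show ?thesis by (simp add: card_points card_image[OF inj])
qed

lemma graph_function_eq_0:
  assumes "u \<in> graph_functions m" "\<And>x. x \<in> pair_reps m \<Longrightarrow> u x = 0"
  shows "u = 0"
proof
  fix x show "u x = 0 x"
  proof (cases "x \<in> points m")
    case True
    then have "x \<in> pair_reps m \<or> mate m x \<in> pair_reps m"
      using mate_neq[OF True] by (auto simp: pair_reps_def)
    then show ?thesis using assms True by (auto simp: graph_functions_iff)
  qed (use assms in \<open>simp add: graph_functions_iff\<close>)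
qed

lemma pair_indicator_dual:
  "x \<in> pair_reps m \<Longrightarrow> y \<in> pair_reps m \<Longrightarrow> pair_indicator m x y = (if x = y then 1 else 0)"
  by (auto simp: pair_indicator_def pair_reps_def)

lemma graph_functions_finite_span:
  "\<exists>F. finite F \<and> graph_functions m \<subseteq> real_functions.span F"
proof -
  have "graph_functions m \<subseteq> real_functions.span (pair_indicator m ` pair_reps m)"
    by (rule dual_evaluation_basis(2)[where a = "\<lambda>x. x", OF subspace_graph_functions])
      (use pair_indicator_in pair_indicator_dual graph_function_eq_0 in \<open>auto simp: pair_reps_def\<close>)
  moreover have "finite (pair_indicator m ` pair_reps m)" by (simp add: pair_reps_def)
  ultimately show ?thesis by blast
qed

lemma rank_nullity_graph_functions:
  assumes "Vector_Spaces.linear scale_fun scale_fun f" "real_functions.subspace S" "S \<subseteq> graph_functions m"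
  shows "real_functions.dim (f ` S) + real_functions.dim {x \<in> S. f x = 0} = real_functions.dim S"
  using graph_functions_finite_span[of m] finite_dimensional_rank_nullity[OF assms(1,2)] assms(3) by blast

section \<open>Multiplicities of extended eigenvalues\<close>

lemma subspace_eigenspace: "real_functions.subspace (eigenspace m l)"
proof -
  have "neg_laplacian m (u + v) x = neg_laplacian m u x + neg_laplacian m v x"
    "neg_laplacian m (scale_fun c u) x = c * neg_laplacian m u x"
    "neg_laplacian m 0 x = 0" for u v x c
    by (simp_all add: neg_laplacian_eq circle_nbrs_def algebra_simps)
  then show ?thesis using subspace_graph_functions[of m]
    by (simp add: real_functions.subspace_def eigenspace_def algebra_simps)
qed

lemma linear_restrict_old: "Vector_Spaces.linear scale_fun scale_fun (restrict_old m)"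
  by (rule linear_scale_funI) (auto simp: restrict_old_def fun_eq_iff)

text \<open>
  Restriction to the old points is an isomorphism of the two eigenspaces, by the three lemmas on spectral
  decimation above.
\<close>

lemma eigen_multiplicity_Suc:
  assumes l: "l \<noteq> 1" "l \<noteq> 3"
  shows "eigen_multiplicity (Suc m) l = eigen_multiplicity m (R l)"
proof -
  let ?E = "eigenspace (Suc m) l"
  have "restrict_old m ` ?E = eigenspace m (R l)"
    using restrict_old_eigenspace[OF _ l] eigenfunction_extension_exists[OF _ l] by blast
  moreover have "{v \<in> ?E. restrict_old m v = 0} = {0}"
    using restrict_old_eq_0D[OF _ l] real_functions.subspace_0[OF subspace_eigenspace]
    by (auto simp: restrict_old_def fun_eq_iff)
  moreover have "real_functions.dim {0} = 0"
    using real_functions.dim_span_eq_card_independent[OF real_functions.independent_empty] by simp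
  ultimately show ?thesis
    using rank_nullity_graph_functions[OF linear_restrict_old subspace_eigenspace, of "Suc m" l "Suc m" m]
    by (auto simp: eigen_multiplicity_def eigenspace_def)
qed

section \<open>The spectral bound\<close>

lemma R_zero_set: "{x. R x = 0} = {0, 3, 5}"
  by (auto simp: R_def)

lemma \<phi>_zero: "\<phi> 1 0 = 0" "\<phi> 2 0 = 3" "\<phi> 3 0 = 5"
proof -
  have "sorted_list_of_set {0, 3, 5::real} = [0, 3, 5]"
    using sorted_list_of_set.idem_if_sorted_distinct[of "[0, 3, 5::real]"] by simp
  then show "\<phi> 1 0 = 0" "\<phi> 2 0 = 3" "\<phi> 3 0 = 5" by (simp_all add: \<phi>_def R_zero_set)
qed

text \<open>
  This is the induction step of the spectral bound. Below \<open>0\<close> the polynomial \<open>R\<close> is negative, and above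
  \<open>4 + sqrt 2\<close> it exceeds the identity because \<open>(1 + sqrt 2) (sqrt 2 - 1) = 1\<close>.
\<close>

lemma R_nonneg_bounded_imp:
  assumes "0 \<le> R x" "R x \<le> 4 + sqrt 2"
  shows "0 \<le> x \<and> x \<le> 4 + sqrt 2"
proof (intro conjI leI notI)
  assume "x < 0"
  then have "0 < (3 - x) * (5 - x)" by simp
  then have "x * ((3 - x) * (5 - x)) < 0" using \<open>x < 0\<close> by (rule mult_neg_pos[rotated])
  then show False using assms(1) by (simp add: R_def mult.assoc)
next
  assume x: "4 + sqrt 2 < x"
  have s: "1 \<le> sqrt 2" by simp
  have "(1 + sqrt 2) * (sqrt 2 - 1) < (x - 3) * (x - 5)"
    using x s by (intro mult_strict_mono) linarith+
  then have "1 < (x - 3) * (x - 5)" by (simp add: algebra_simps)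
  then have "x * 1 < x * ((x - 3) * (x - 5))" using x s by (intro mult_strict_left_mono) linarith+
  also have "\<dots> = R x" by (simp add: R_def algebra_simps)
  finally show False using assms(2) x by simp
qed

text \<open>
  On level \<open>0\<close> there is one vertex with two loops, hence only the eigenvalue \<open>0\<close>. An eigenvalue
  \<open>l\<close> of the next level is \<open>1\<close>, \<open>3\<close>, or such that \<open>R l\<close> is an eigenvalue of the present level.
\<close>

lemma eigenvalue_bounds: "eigenvalue m l \<Longrightarrow> 0 \<le> l \<and> l \<le> 4 + sqrt 2"
proof (induction m arbitrary: l)
  case 0
  then obtain u where u: "u \<in> eigenspace 0 l" "u \<noteq> 0" by (auto simp: eigenvalue_def eigenfunction_def)
  have g: "u \<in> graph_functions 0" using u by (simp add: eigenspace_def)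
  have const: "u x = u (circ 0 1)" if x: "x \<in> points 0" for x
  proof -
    have "{1..2 * 5 ^ 0} = {1, 2::int}" by auto
    then have "points 0 = {circ 0 1, circ 0 2}"
      unfolding points_circ_image by simp
    moreover have "u (mate 0 (circ 0 1)) = u (circ 0 1)"
      using g circ_in_points[of 0 1] unfolding graph_functions_iff by blast
    ultimately show ?thesis using that by (auto simp: mate_circ_1)
  qed
  have "circle_nbrs 0 u x = 2 * u (circ 0 1)" if x: "x \<in> points 0" for x
  proof -
    obtain n where "x = circ 0 n" using x by (rule pointsE)
    then show ?thesis 
      using const[of "circ 0 (n + 1)"] const[of "circ 0 (n - 1)"] by (simp add: circle_nbrs_circ)
  qed
  then have "neg_laplacian 0 u (circ 0 1) = 0"
    by (simp add: neg_laplacian_eq const[OF mate_in_points])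
  then have "l * u (circ 0 1) = 0" using u by (simp add: eigenspace_def)
  moreover have "u (circ 0 1) \<noteq> 0"
  proof
    assume "u (circ 0 1) = 0"
    then have "u x = 0" for x
      using const[of x] g by (cases "x \<in> points 0") (auto simp: graph_functions_def)
    then show False using u(2) by (simp add: fun_eq_iff)
  qed
  ultimately show ?case by simp
next
  case (Suc m)
  then obtain v where v: "v \<in> eigenspace (Suc m) l" "v \<noteq> 0" by (auto simp: eigenvalue_def eigenfunction_def)
  show ?case
  proof (cases "l = 1 \<or> l = 3")
    case False
    then have "eigenfunction m (R l) (restrict_old m v)"
      using v restrict_old_eigenspace restrict_old_eq_0D by (auto simp: eigenfunction_def)
    then have "0 \<le> R l \<and> R l \<le> 4 + sqrt 2" using Suc.IH by (auto simp: eigenvalue_def)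
    then show ?thesis using R_nonneg_bounded_imp by blast
  qed auto
qed

section \<open>The eigenvalues 1 and 3 belong to born eigenfunctions\<close>

lemma sum_points_rotate:
  "(\<Sum>x\<in>points m. f (wrap (x - 1 / (2 * 5 ^ m)))) = (\<Sum>x\<in>points m. f x)" for f :: "real \<Rightarrow> real"
proof -
  have s: "wrap (circ m n - 1 / (2 * 5 ^ m)) = circ m (n - 1)" "wrap (circ m n + 1 / (2 * 5 ^ m)) = circ m (n + 1)" for n
    using wrap_circ_add[of m n "-1"] wrap_circ_add[of m n 1] by simp_all
  show ?thesis
    by (rule sum.reindex_bij_witness[where i = "\<lambda>x. wrap (x + 1 / (2 * 5 ^ m))" and j = "\<lambda>x. wrap (x - 1 / (2 * 5 ^ m))"])
      (auto elim!: pointsE simp: s)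
qed

lemma sum_points_mate: "(\<Sum>x\<in>points m. f (mate m x)) = (\<Sum>x\<in>points m. f x)" for f :: "real \<Rightarrow> real"
  by (rule sum.reindex_bij_witness[where i = "mate m" and j = "mate m"]) auto

text \<open>
  Every old point is the end of two arcs, one on each side, so summing over the old points and regrouping counts
  both new values on each arc. The factor \<open>2\<close> arises because each pair is visited from both of its points.
\<close>

lemma sum_circle_nbrs_arcs:
  "(\<Sum>x\<in>points m. circle_nbrs (Suc m) v x + circle_nbrs (Suc m) v (mate m x))
    = 2 * (\<Sum>x\<in>points m. v (wrap (x + 1 / (2 * 5 ^ Suc m))) + v (wrap (x + 4 / (2 * 5 ^ Suc m))))"
proof -
  let ?q = "\<lambda>x. v (wrap (x + 4 / (2 * 5 ^ Suc m)))"
  have "circle_nbrs (Suc m) v x = v (wrap (x + 1 / (2 * 5 ^ Suc m))) + ?q (wrap (x - 1 / (2 * 5 ^ m)))" for x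
  proof -
    have "x - 1 / (2 * 5 ^ m) + 4 / (2 * 5 ^ Suc m) = x - 1 / (2 * 5 ^ Suc m)"
      by (simp add: field_simps)
    then show ?thesis by (simp only: circle_nbrs_def wrap_wrap_add)
  qed
  then have "(\<Sum>x\<in>points m. circle_nbrs (Suc m) v x)
      = (\<Sum>x\<in>points m. v (wrap (x + 1 / (2 * 5 ^ Suc m)))) + (\<Sum>x\<in>points m. ?q (wrap (x - 1 / (2 * 5 ^ m))))"
    by (simp only: sum.distrib)
  also note sum_points_rotate[where m = m and f = ?q]
  finally have "(\<Sum>x\<in>points m. circle_nbrs (Suc m) v x)
      = (\<Sum>x\<in>points m. v (wrap (x + 1 / (2 * 5 ^ Suc m))) + ?q x)" by (simp only: sum.distrib)
  then show ?thesis by (simp only: sum.distrib sum_points_mate) simp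
qed

lemma wrap_arc:
  "wrap (circ m n + 1 / (2 * 5 ^ Suc m)) = circ (Suc m) (5 * n + 1)"
  "wrap (circ m n + 4 / (2 * 5 ^ Suc m)) = circ (Suc m) (5 * n + 4)"
  using wrap_circ_add[of "Suc m" "5 * n" 1] wrap_circ_add[of "Suc m" "5 * n" 4]
  by (simp_all add: circ_Suc_mult5)

text \<open>
  With \<open>(2 - l)\<^sup>2 = 1\<close>, the two equations on an arc imply \<open>b = (l - 2) a\<close>, so all old values
  are \<open>0\<close> once one of them is.
\<close>

lemma eigenspace_1_3_vanishes:
  assumes v: "v \<in> eigenspace (Suc m) l" and l: "l = 1 \<or> l = 3" and x: "x \<in> points m"
  shows "v x = 0"
proof -
  note e = v[unfolded eigenspace_Suc_iff]
  have new: "(2 - l) * v (circ (Suc m) (5 * j + 1)) = v (circ m j) + v (circ (Suc m) (5 * j + 4))"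
    "(2 - l) * v (circ (Suc m) (5 * j + 4)) = v (circ (Suc m) (5 * j + 1)) + v (circ m (j + 1))" for j
    using e by blast+
  have step: "v (circ m (j + 1)) = (l - 2) * v (circ m j)" for j
    using new[of j] l by auto
  have spread: "v (circ m j) = 0" if "v (circ m 1) = 0" for j
  proof (induction j rule: int_induct[where k = 1])
    case (step1 i)
    then show ?case by (simp add: step)
  next
    case (step2 i)
    then show ?case using step[of "i - 1"] l by auto
  qed (rule that)
  have "v (circ m 1) = 0" using l
  proof
    assume "l = 1"
    then have "v (circ m 2) = - v (circ m 1)" using step[of 1] by simp
    moreover have "v (circ m 2) = v (circ m 1)"
    proof -
      have "v (mate m (circ m 1)) = v (circ m 1)"
        using e circ_in_points[of m 1] unfolding graph_functions_Suc_iff by blast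
      then show ?thesis by (simp add: mate_circ_1)
    qed
    ultimately show ?thesis by simp
  next
    assume l3: "l = 3"
    have const: "v (circ m j) = v (circ m 1)" for j
    proof (induction j rule: int_induct[where k = 1])
      case (step1 i)
      then show ?case by (simp add: step l3)
    next
      case (step2 i)
      then show ?case using step[of "i - 1"] l3 by simp
    qed simp
    \<comment> \<open>Both sides of the equation at the old vertices are summed; on each arc \<open>p + q = - a\<close>.\<close>
    have "(\<Sum>x\<in>points m. v x) = (\<Sum>x\<in>points m. circle_nbrs (Suc m) v x + circle_nbrs (Suc m) v (mate m x))"
      using e l3 by (intro sum.cong) auto
    also have "\<dots> = 2 * (\<Sum>x\<in>points m. - v x)"
      unfolding sum_circle_nbrs_arcs
    proof (intro arg_cong[where f = "\<lambda>t. 2 * t"] sum.cong refl)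
      fix x assume "x \<in> points m"
      then obtain n where n: "x = circ m n" by (rule pointsE)
      show "v (wrap (x + 1 / (2 * 5 ^ Suc m))) + v (wrap (x + 4 / (2 * 5 ^ Suc m))) = - v x"
        unfolding n wrap_arc using new(1)[of n] l3 by simp
    qed
    finally have "(\<Sum>x\<in>points m. v x) = 0" by (simp add: sum_negf)
    moreover have "(\<Sum>x\<in>points m. v x) = (\<Sum>x\<in>points m. v (circ m 1))"
      by (intro sum.cong) (auto elim!: pointsE intro: const)
    ultimately show ?thesis by (simp add: card_points)
  qed
  then show ?thesis using spread x by (auto elim!: pointsE)
qed

section \<open>Multiplicities of the born eigenvalues\<close>

text \<open>
  Functions on the edges of the graph of level \<open>m\<close>, encoded on level \<open>m + 1\<close>: the value on the \<open>j\<close>-th edge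
  is the one at \<open>5 j + 1\<close>, and the sign \<open>\<mu>\<close> relates it to the value at the other end of the edge.
\<close>

definition arc_functions :: "nat \<Rightarrow> real \<Rightarrow> (real \<Rightarrow> real) set" where
  "arc_functions m \<mu> = {v \<in> graph_functions (Suc m). (\<forall>x\<in>points m. v x = 0) \<and>
     (\<forall>j. v (circ (Suc m) (5 * j + 4)) = \<mu> * v (circ (Suc m) (5 * j + 1)))}"

text \<open>
  The incidence matrix of the graph of level \<open>m\<close>, unsigned on \<open>arc_functions m 1\<close> and signed on
  \<open>arc_functions m (-1)\<close>.
\<close>

definition vertex_sum :: "nat \<Rightarrow> (real \<Rightarrow> real) \<Rightarrow> real \<Rightarrow> real" where
  "vertex_sum m v x =
     (if x \<in> points m then circle_nbrs (Suc m) v x + circle_nbrs (Suc m) v (mate m x) else 0)"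

text \<open>
  For vanishing old values both equations on an arc reduce to \<open>q = (2 - l) p\<close>, and the
  equation at an old vertex says that the sum over its new neighbours is \<open>0\<close>.
\<close>

lemma eigenspace_eq_kernel:
  assumes l: "l = 1 \<or> l = 3"
  shows "eigenspace (Suc m) l = {v \<in> arc_functions m (2 - l). vertex_sum m v = 0}"
proof (intro set_eqI iffI)
  fix v assume v: "v \<in> eigenspace (Suc m) l"
  note z = eigenspace_1_3_vanishes[OF v l]
  show "v \<in> {v \<in> arc_functions m (2 - l). vertex_sum m v = 0}"
    using v[unfolded eigenspace_Suc_iff] z by (auto simp: arc_functions_def vertex_sum_def fun_eq_iff)
next
  fix v assume v: "v \<in> {v \<in> arc_functions m (2 - l). vertex_sum m v = 0}"
  then have z: "\<And>x. x \<in> points m \<Longrightarrow> v x = 0" and g: "v \<in> graph_functions (Suc m)"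
    and q: "\<And>j. v (circ (Suc m) (5 * j + 4)) = (2 - l) * v (circ (Suc m) (5 * j + 1))"
    by (auto simp: arc_functions_def)
  have "circle_nbrs (Suc m) v x + circle_nbrs (Suc m) v (mate m x) = 0" if "x \<in> points m" for x
  proof -
    have "vertex_sum m v x = 0" using v by simp
    then show ?thesis using that by (simp add: vertex_sum_def)
  qed
  then show "v \<in> eigenspace (Suc m) l"
    unfolding eigenspace_Suc_iff using g l by (auto simp: z q)
qed

lemma linear_vertex_sum: "Vector_Spaces.linear scale_fun scale_fun (vertex_sum m)"
  by (rule linear_scale_funI) (simp_all add: vertex_sum_def circle_nbrs_def fun_eq_iff algebra_simps)

lemma subspace_arc_functions: "real_functions.subspace (arc_functions m \<mu>)"
  using subspace_graph_functions[of "Suc m"]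
  by (simp add: real_functions.subspace_def arc_functions_def algebra_simps)

definition arc_bump :: "nat \<Rightarrow> real \<Rightarrow> int \<Rightarrow> real \<Rightarrow> real" where
  "arc_bump m \<mu> k = fill m (\<lambda>_. 0) (\<lambda>j. of_bool (circ m j = circ m k)) (\<lambda>j. \<mu> * of_bool (circ m j = circ m k))"

lemma arc_bump_values:
  "arc_bump m \<mu> k (circ m j) = 0"
  "arc_bump m \<mu> k (circ (Suc m) (5 * j + 1)) = of_bool (circ m j = circ m k)"
  "arc_bump m \<mu> k (circ (Suc m) (5 * j + 4)) = \<mu> * of_bool (circ m j = circ m k)"
  unfolding arc_bump_def by (simp_all add: fill_circ circ_add_period)

lemma arc_bump_in: "arc_bump m \<mu> k \<in> arc_functions m \<mu>"
proof -
  have "arc_bump m \<mu> k \<in> graph_functions (Suc m)"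
    unfolding arc_bump_def
    by (rule fill_graph_function[OF real_functions.subspace_0[OF subspace_graph_functions]])
      (simp_all add: circ_add_period)
  moreover have "arc_bump m \<mu> k x = 0" if "x \<in> points m" for x
    using that by (auto elim!: pointsE simp: arc_bump_values)
  ultimately show ?thesis by (simp add: arc_functions_def arc_bump_values)
qed

lemma dim_arc_functions: "real_functions.dim (arc_functions m \<mu>) = 2 * 5 ^ m"
proof -
  let ?I = "{1..2 * 5 ^ m :: int}"
  have "real_functions.dim (arc_functions m \<mu>) = card ?I"
  proof (rule dual_evaluation_basis(1)[where b = "arc_bump m \<mu>" and a = "\<lambda>j. circ (Suc m) (5 * j + 1)"])
    fix i k assume ik: "i \<in> ?I" "k \<in> ?I"
    have "circ m k = circ m i \<longleftrightarrow> i = k"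
    proof
      assume "circ m k = circ m i"
      then have "2 * 5 ^ m dvd k - i" by (simp add: circ_eq_iff)
      moreover have "\<bar>k - i\<bar> < 2 * 5 ^ m" using ik by auto
      ultimately show "i = k" by (metis dvd_imp_le_int abs_numeral abs_of_nonneg eq_iff_diff_eq_0 not_le zero_le_mult_iff zero_le_numeral zero_le_power)
    qed simp
    then show "arc_bump m \<mu> i (circ (Suc m) (5 * k + 1)) = (if i = k then 1 else 0)"
      by (simp add: arc_bump_values)
  next
    fix v assume v: "v \<in> arc_functions m \<mu>"
      and z: "\<And>k. k \<in> ?I \<Longrightarrow> v (circ (Suc m) (5 * k + 1)) = 0"
    have p: "v (circ (Suc m) (5 * j + 1)) = 0" for j
    proof -
      have "circ m j \<in> circ m ` ?I" using circ_in_points[of m j] by (simp only: points_circ_image)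
      then obtain k where k: "k \<in> ?I" "circ m j = circ m k" by blast
      then have "wrap (circ m j + 1 / (2 * 5 ^ Suc m)) = wrap (circ m k + 1 / (2 * 5 ^ Suc m))" by simp
      then have "circ (Suc m) (5 * j + 1) = circ (Suc m) (5 * k + 1)" by (simp only: wrap_arc)
      then show ?thesis using z[OF k(1)] by simp
    qed
    show "v = 0"
      by (rule graph_function_Suc_eq_0) (use v p in \<open>auto simp: arc_functions_def\<close>)
  qed (simp_all add: subspace_arc_functions arc_bump_in)
  then show ?thesis by (simp add: nat_mult_distrib nat_power_eq)
qed

text \<open>
  A column of the incidence matrix: the \<open>k\<close>-th edge joins the vertices of the points \<open>k\<close> and \<open>k + 1\<close>.
\<close>

lemma vertex_sum_arc_bump:
  "vertex_sum m (arc_bump m \<mu> k) = pair_indicator m (circ m k) + scale_fun \<mu> (pair_indicator m (circ m (k + 1)))"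
proof
  fix y
  have nb: "circle_nbrs (Suc m) (arc_bump m \<mu> k) z = of_bool (z = circ m k) + \<mu> * of_bool (z = circ m (k + 1))"
    if z: "z \<in> points m" for z
  proof -
    obtain n where n: "z = circ m n" using z by (rule pointsE)
    have i: "5 * n - 1 = 5 * (n - 1) + 4" by simp
    have c: "circ m (n - 1) = circ m k \<longleftrightarrow> circ m n = circ m (k + 1)"
      by (simp add: circ_eq_iff algebra_simps)
    show ?thesis unfolding n circle_nbrs_old i arc_bump_values c ..
  qed
  have ind: "pair_indicator m x y = of_bool (y = x) + of_bool (mate m y = x)"
    if "x \<in> points m" "y \<in> points m" for x
    using that mate_neq[of x m] by (auto simp: pair_indicator_def)
  show "vertex_sum m (arc_bump m \<mu> k) y = (pair_indicator m (circ m k) + scale_fun \<mu> (pair_indicator m (circ m (k + 1)))) y"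
  proof (cases "y \<in> points m")
    case True
    then show ?thesis by (simp add: vertex_sum_def nb ind algebra_simps)
  next
    case False
    then have "y \<noteq> circ m j" "y \<noteq> mate m (circ m j)" for j by auto
    then show ?thesis using False by (simp add: vertex_sum_def pair_indicator_def)
  qed
qed

lemma vertex_sum_in_graph_functions:
  "vertex_sum m v \<in> graph_functions m"
  by (simp add: graph_functions_iff vertex_sum_def)

lemma subspace_vertex_sum_image: "real_functions.subspace (vertex_sum m ` arc_functions m \<mu>)"
proof -
  interpret T: Vector_Spaces.linear scale_fun scale_fun "vertex_sum m" by (rule linear_vertex_sum)
  show ?thesis by (rule T.subspace_image[OF subspace_arc_functions])
qed

text \<open>
  The image contains the sum of the indicators of the two ends of each edge. The loop at the vertex of the
  points \<open>1\<close> and \<open>2\<close> yields twice the indicator of this vertex, and walking around the circle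
  yields all other indicators.
\<close>

lemma dim_vertex_sum_image_1: "real_functions.dim (vertex_sum m ` arc_functions m 1) = 5 ^ m"
proof -
  let ?W = "vertex_sum m ` arc_functions m 1"
  note W = subspace_vertex_sum_image[of m 1]
  have edge: "pair_indicator m (circ m k) + pair_indicator m (circ m (k + 1)) \<in> ?W" for k
  proof -
    have "vertex_sum m (arc_bump m 1 k) \<in> ?W" by (intro imageI arc_bump_in)
    then show ?thesis by (simp add: vertex_sum_arc_bump)
  qed
  have "pair_indicator m (circ m 2) = pair_indicator m (circ m 1)"
    using pair_indicator_mate[of "circ m 1" m] by (simp add: mate_circ_1)
  then have "pair_indicator m (circ m 1) = scale_fun (1/2) (pair_indicator m (circ m 1) + pair_indicator m (circ m (1 + 1)))"
    by (simp add: fun_eq_iff)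
  then have first: "pair_indicator m (circ m 1) \<in> ?W"
    using real_functions.subspace_scale[OF W edge[of 1], of "1/2"] by simp
  have "pair_indicator m (circ m k) \<in> ?W" for k
  proof (induction k rule: int_induct[where k = 1])
    case (step1 i)
    then show ?case using real_functions.subspace_diff[OF W edge[of i] step1(2)] by simp
  next
    case (step2 i)
    then show ?case using real_functions.subspace_diff[OF W edge[of "i - 1"] step2(2)] by simp
  qed (rule first)
  then have "pair_indicator m x \<in> ?W" if "x \<in> pair_reps m" for x
    using that by (auto simp: pair_reps_def elim!: pointsE)
  moreover have "v = 0" if "v \<in> ?W" "\<And>x. x \<in> pair_reps m \<Longrightarrow> v x = 0" for v
    using that vertex_sum_in_graph_functions by (intro graph_function_eq_0[of v m]) auto
  ultimately have "real_functions.dim ?W = card (pair_reps m)"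
    by (intro dual_evaluation_basis(1)[where b = "pair_indicator m" and a = "\<lambda>x. x"] W pair_indicator_dual)
      (simp_all add: pair_reps_def)
  then show ?thesis by (simp add: card_pair_reps)
qed

text \<open>
  Each edge contributes with opposite signs to its two ends.
\<close>

lemma sum_vertex_sum:
  assumes "v \<in> arc_functions m (-1)"
  shows "(\<Sum>x\<in>points m. vertex_sum m v x) = 0"
proof -
  have "(\<Sum>x\<in>points m. vertex_sum m v x)
      = (\<Sum>x\<in>points m. circle_nbrs (Suc m) v x + circle_nbrs (Suc m) v (mate m x))"
    by (intro sum.cong) (simp_all add: vertex_sum_def)
  also have "\<dots> = 2 * (\<Sum>x\<in>points m. 0)"
    unfolding sum_circle_nbrs_arcs
  proof (intro arg_cong[where f = "\<lambda>t. 2 * t"] sum.cong refl)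
    fix x assume "x \<in> points m"
    then obtain n where n: "x = circ m n" by (rule pointsE)
    show "v (wrap (x + 1 / (2 * 5 ^ Suc m))) + v (wrap (x + 4 / (2 * 5 ^ Suc m))) = 0"
      unfolding n wrap_arc using assms by (simp add: arc_functions_def)
  qed
  finally show ?thesis by simp
qed

text \<open>
  Walking around the circle from the point \<open>1\<close>, the differences along the edges yield all differences
  of indicators of vertices. By \<open>sum_vertex_sum\<close> nothing else lies in the image: a function there that vanishes
  at all vertices but one vanishes at this vertex too. So the vertices other than that of the point \<open>1\<close> index a basis.
\<close>

lemma dim_vertex_sum_image_minus_1:
  "real_functions.dim (vertex_sum m ` arc_functions m (-1)) = 5 ^ m - 1"
proof -
  let ?W = "vertex_sum m ` arc_functions m (-1)"
  let ?b = "\<lambda>x. pair_indicator m x - pair_indicator m (circ m 1)"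
  note W = subspace_vertex_sum_image[of m "-1"]
  have edge: "pair_indicator m (circ m k) - pair_indicator m (circ m (k + 1)) \<in> ?W" for k
  proof -
    have "vertex_sum m (arc_bump m (-1) k) \<in> ?W" by (intro imageI arc_bump_in)
    moreover have "vertex_sum m (arc_bump m (-1) k) = pair_indicator m (circ m k) - pair_indicator m (circ m (k + 1))"
      by (simp add: vertex_sum_arc_bump fun_eq_iff)
    ultimately show ?thesis by simp
  qed
  have "?b (circ m k) \<in> ?W" for k
  proof (induction k rule: int_induct[where k = 1])
    case base
    show ?case using real_functions.subspace_0[OF W] by (simp add: zero_fun_def)
  next
    case (step1 i)
    then show ?case using real_functions.subspace_diff[OF W step1(2) edge[of i]] by (simp add: fun_diff_def)
  next
    case (step2 i)
    then show ?case using real_functions.subspace_add[OF W edge[of "i - 1"] step2(2)] by (simp add: fun_diff_def plus_fun_def)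
  qed
  then have bW: "?b x \<in> ?W" if "x \<in> points m" for x
    using that by (auto elim!: pointsE)
  \<comment> \<open>The point \<open>1\<close> represents its pair, so removing it leaves \<open>5 ^ m - 1\<close> representatives.\<close>
  have "(1::nat) \<le> 5 ^ m" by simp
  then have "circ m 1 = pt m 1" "circ m 2 = pt m 2"
    using circ_eq_pt[of 1 m] circ_eq_pt[of 2 m] by simp_all
  moreover have "pt m 1 < pt m 2" unfolding pt_def by (rule divide_strict_right_mono) simp_all
  ultimately have "circ m 1 < circ m 2" by simp
  then have rep: "circ m 1 \<in> pair_reps m" by (simp add: pair_reps_def mate_circ_1)
  have dual: "?b x y = (if x = y then 1 else 0)"
    if "x \<in> pair_reps m - {circ m 1}" "y \<in> pair_reps m - {circ m 1}" for x y
    using that rep by (auto simp: pair_indicator_dual)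
  have zero: "w = 0" if w: "w \<in> ?W" and z: "\<And>x. x \<in> pair_reps m - {circ m 1} \<Longrightarrow> w x = 0" for w
  proof -
    obtain v where v: "v \<in> arc_functions m (-1)" "w = vertex_sum m v" using w by blast
    have g: "w \<in> graph_functions m" unfolding v by (rule vertex_sum_in_graph_functions)
    have "w (mate m (circ m 1)) = w (circ m 1)"
      using g circ_in_points[of m 1] unfolding graph_functions_iff by blast
    then have c: "w (circ m 2) = w (circ m 1)" "circ m 1 \<noteq> circ m 2"
      using \<open>circ m 1 < circ m 2\<close> by (simp_all add: mate_circ_1)
    have "w x = 0" if "x \<in> points m - {circ m 1, circ m 2}" for x
    proof (cases "x \<in> pair_reps m")
      case True
      then show ?thesis using z that by blast
    next
      case False
      then have "mate m x \<in> pair_reps m"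
        using that mate_neq[of x m] by (auto simp: pair_reps_def)
      moreover have "mate m x \<noteq> circ m 1"
        using that mate_mate[of x m] mate_circ_1[of m] by (metis Diff_iff insertCI)
      ultimately show ?thesis using z[of "mate m x"] g that by (simp add: graph_functions_iff)
    qed
    then have "(\<Sum>x\<in>points m. w x) = (\<Sum>x\<in>{circ m 1, circ m 2}. w x)"
      by (intro sum.mono_neutral_right) auto
    also have "\<dots> = 2 * w (circ m 1)" using c by simp
    finally have "w (circ m 1) = 0" using sum_vertex_sum[OF v(1)] v(2) by simp
    then show ?thesis using z by (intro graph_function_eq_0[OF g]) blast
  qed
  have "real_functions.dim ?W = card (pair_reps m - {circ m 1})"
    by (rule dual_evaluation_basis(1)[where b = ?b and a = "\<lambda>x. x"])
      (use W bW dual zero in \<open>auto simp: pair_reps_def\<close>)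
  then show ?thesis using rep by (simp add: card_pair_reps)
qed

lemma eigen_multiplicity_1_3_rank_nullity:
  assumes "l = 1 \<or> l = 3"
  shows "real_functions.dim (vertex_sum m ` arc_functions m (2 - l)) + eigen_multiplicity (Suc m) l = 2 * 5 ^ m"
  unfolding eigen_multiplicity_def eigenspace_eq_kernel[OF assms] dim_arc_functions[of m "2 - l", symmetric]
  by (rule rank_nullity_graph_functions[OF linear_vertex_sum subspace_arc_functions, where m = "Suc m"])
    (auto simp: arc_functions_def)

section \<open>The spectrum on the next level\<close>

theorem theorem2p2:
  fixes m :: nat
  shows "(\<forall>v l'. eigenfunction (Suc m) l' v \<longrightarrow>
            (born_next m v \<and> l' \<in> {1, 3}) \<or>
            ((\<exists>u l. eigenfunction m l u \<and> extension_of m v u) \<and>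
             (\<forall>u l. eigenfunction m l u \<and> extension_of m v u \<longrightarrow>
                (\<exists>i\<in>allowed l. l' = \<phi> i l))))
       \<and> eigen_multiplicity (Suc m) 1 = 5 ^ m
       \<and> eigen_multiplicity (Suc m) 3 = 5 ^ m + 1
       \<and> \<phi> 1 0 = 0 \<and> \<phi> 3 0 = 5
       \<and> (\<forall>l. eigenvalue m l \<longrightarrow>
            (\<forall>i\<in>allowed l. eigenvalue (Suc m) (\<phi> i l) \<and>
               eigen_multiplicity (Suc m) (\<phi> i l) = eigen_multiplicity m l))"
proof (intro conjI allI impI ballI)
  fix v l'
  assume v: "eigenfunction (Suc m) l' v"
  then have vE: "v \<in> eigenspace (Suc m) l'" and v0: "v \<noteq> 0" by (simp_all add: eigenfunction_def)
  show "(born_next m v \<and> l' \<in> {1, 3}) \<or>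
            ((\<exists>u l. eigenfunction m l u \<and> extension_of m v u) \<and>
             (\<forall>u l. eigenfunction m l u \<and> extension_of m v u \<longrightarrow>
                (\<exists>i\<in>allowed l. l' = \<phi> i l)))"
  proof (cases "l' = 1 \<or> l' = 3")
    case True
    then show ?thesis using eigenspace_1_3_vanishes[OF vE] by (auto simp: born_next_def)
  next
    case False
    then have l': "l' \<noteq> 1" "l' \<noteq> 3" by auto
    have rE: "restrict_old m v \<in> eigenspace m (R l')" by (rule restrict_old_eigenspace[OF vE l'])
    have "eigenfunction m (R l') (restrict_old m v)"
      using rE restrict_old_eq_0D[OF vE l'] v0 by (auto simp: eigenfunction_def)
    moreover have "extension_of m v (restrict_old m v)"
      using rE vE by (simp add: extension_of_def eigenspace_def restrict_old_def)
    moreover have "\<exists>i\<in>allowed l. l' = \<phi> i l" if u: "eigenfunction m l u" "extension_of m v u" for u l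
    proof -
      have ur: "u = restrict_old m v"
        using u(2) by (auto simp: extension_of_def restrict_old_def graph_functions_iff fun_eq_iff)
      obtain x where x: "u x \<noteq> 0" using u(1) by (auto simp: eigenfunction_def fun_eq_iff)
      then have "x \<in> points m" by (auto simp: ur restrict_old_def split: if_splits)
      then have "l * u x = R l' * u x"
        using u(1) rE unfolding ur [symmetric] by (auto simp: eigenfunction_def eigenspace_def)
      then have l: "R l' = l" using x by simp
      have "0 \<le> l" "l \<le> 4 + sqrt 2" using eigenvalue_bounds[of m l] u(1) by (auto simp: eigenvalue_def)
      from \<phi>_solutions(3)[OF this] l have "l' \<in> {\<phi> 1 l, \<phi> 2 l, \<phi> 3 l}" by blast
      \<comment> \<open>For \<open>l = 0\<close> the middle solution is \<open>3\<close>, which is excluded in this case.\<close>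
      then show ?thesis using l'(2) \<phi>_zero(2) by (auto simp: allowed_def)
    qed
    ultimately show ?thesis by blast
  qed
next
  show "eigen_multiplicity (Suc m) 1 = 5 ^ m"
    using eigen_multiplicity_1_3_rank_nullity[of 1 m] by (simp add: dim_vertex_sum_image_1)
  have "5 ^ m + eigen_multiplicity (Suc m) 3 - 1 = 2 * 5 ^ m"
    using eigen_multiplicity_1_3_rank_nullity[of 3 m] dim_vertex_sum_image_minus_1[of m]
    by (simp del: One_nat_def)
  moreover have "(1::nat) \<le> 5 ^ m" by simp
  ultimately show "eigen_multiplicity (Suc m) 3 = 5 ^ m + 1" by linarith
  show "\<phi> 1 0 = 0" "\<phi> 3 0 = 5" by (fact \<phi>_zero)+
next
  fix l i
  assume l: "eigenvalue m l" and i: "i \<in> allowed l"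
  have b: "0 \<le> l" "l \<le> 4 + sqrt 2" using eigenvalue_bounds[OF l] by auto
  have R: "R (\<phi> i l) = l"
    using \<phi>_solutions(3)[OF b] i by (auto simp: allowed_def split: if_splits)
  \<comment> \<open>\<open>R 1 = 8\<close> exceeds the spectral bound, and the solution \<open>3\<close> of \<open>R x = 0\<close> is the choice excluded for \<open>l = 0\<close>.\<close>
  have "sqrt 2 < 4" by (rule real_less_lsqrt) auto
  then have n1: "\<phi> i l \<noteq> 1" using R b by (auto simp: R_def)
  have n3: "\<phi> i l \<noteq> 3"
    using R i \<phi>_zero by (auto simp: R_def allowed_def split: if_splits)
  show "eigen_multiplicity (Suc m) (\<phi> i l) = eigen_multiplicity m l"
    using eigen_multiplicity_Suc[OF n1 n3] by (simp add: R)
  obtain u where u: "u \<in> eigenspace m l" "u \<noteq> 0" using l by (auto simp: eigenvalue_def eigenfunction_def)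
  then obtain v where v: "v \<in> eigenspace (Suc m) (\<phi> i l)" "restrict_old m v = u"
    using eigenfunction_extension_exists[of u m "\<phi> i l"] n1 n3 R by auto
  have "v \<noteq> 0"
  proof
    assume "v = 0"
    then have "restrict_old m v = 0" by (simp add: restrict_old_def fun_eq_iff)
    then show False using v(2) u(2) by simp
  qed
  then show "eigenvalue (Suc m) (\<phi> i l)" using v by (auto simp: eigenvalue_def eigenfunction_def)
qed

end
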